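(* Let $n\ge2$. For $1\le i\le n$, let $\rho_i\in\mathrm{SymOut}(F_n)$ be the element represented by the automorphism of $F_n$ that inverts the $i$th generator (and fixes the other generators). Then the kernel of the map $\mathcal{P}_n:\mathrm{SymOut}(F_n)\to\mathrm{SymOut}(H_n)$ is the $\mathrm{SymOut}(F_n)$-normal closure of the set $\{\rho_1,\dots,\rho_n\}$.
   Context: $F_n$ is the free group with fixed basis $y_1,\dots,y_n$, and $H_n=(\mathbb{Z}/2\mathbb{Z})^{*n}$ is the $n$-fold free product with standard order-$2$ generators $z_1,\dots,z_n$. A symmetric automorphism of $F_n$ (resp. $H_n$) is an automorphism mapping each generator to a conjugate of some generator or its inverse; $\mathrm{SymOut}(F_n)$ (resp. $\mathrm{SymOut}(H_n)$) is the image of the group of symmetric automorphisms in $\mathrm{Out}(F_n)$ (resp. $\mathrm{Out}(H_n)$). Let $\pi:F_n\to H_n$, $y_i\mapsto z_i$, be reduction of each generator mod $2$. Every symmetric automorphism of $F_n$ preserves $\mathrm{Ker}(\pi)$, and $\mathcal{P}_n$ is the induced map on symmetric outer automorphism groups. *)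

theory Defs
  imports "HOL-Algebra.Algebra"
begin

section \<open>Free groups\<close>

text \<open>A letter is a pair of a generator and a sign, \<open>(i, True)\<close> standing for the generator \<open>i\<close> and
  \<open>(i, False)\<close> for its inverse. The free group consists of the freely reduced words; the product
  is concatenation followed by free reduction.\<close>

definition freely_reduced :: "('a \<times> bool) list \<Rightarrow> bool" where
  "freely_reduced = successively (\<lambda>(i, b) (j, c). \<not> (i = j \<and> b \<noteq> c))"

fun free_cons :: "'a \<times> bool \<Rightarrow> ('a \<times> bool) list \<Rightarrow> ('a \<times> bool) list" where
  "free_cons x [] = [x]"
| "free_cons (i, b) ((j, c) # w) = (if i = j \<and> b \<noteq> c then w else (i, b) # (j, c) # w)"

definition free_group :: "'a set \<Rightarrow> ('a \<times> bool) list monoid" where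
  "free_group I =
     \<lparr>carrier = {w. fst ` set w \<subseteq> I \<and> freely_reduced w},
      monoid.mult = foldr free_cons,
      one = []\<rparr>"

definition free_gen :: "'a \<Rightarrow> ('a \<times> bool) list" where
  "free_gen i = [(i, True)]"

text \<open>The homomorphism from a free group to \<open>G\<close> that sends each generator \<open>i\<close> to \<open>f i\<close>.\<close>

definition free_lift :: "('b, 'm) monoid_scheme \<Rightarrow> ('a \<Rightarrow> 'b) \<Rightarrow> ('a \<times> bool) list \<Rightarrow> 'b" where
  "free_lift G f w =
     foldr (\<lambda>(i, b) u. (if b then f i else inv\<^bsub>G\<^esub> (f i)) \<otimes>\<^bsub>G\<^esub> u) w \<one>\<^bsub>G\<^esub>"


section \<open>Free products\<close>

text \<open>The free product of the groups \<open>G i\<close> for \<open>i\<close> in \<open>I\<close> consists of the words of syllables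
  \<open>(i, g)\<close> with \<open>g\<close> a nontrivial element of \<open>G i\<close>, such that adjacent syllables come from
  different factors.\<close>

fun syllable_cons :: "('i \<Rightarrow> ('a, 'm) monoid_scheme) \<Rightarrow> 'i \<times> 'a \<Rightarrow> ('i \<times> 'a) list \<Rightarrow> ('i \<times> 'a) list" where
  "syllable_cons G (i, g) [] = (if g = \<one>\<^bsub>G i\<^esub> then [] else [(i, g)])"
| "syllable_cons G (i, g) ((j, h) # w) =
     (if g = \<one>\<^bsub>G i\<^esub> then (j, h) # w
      else if i = j then (if g \<otimes>\<^bsub>G i\<^esub> h = \<one>\<^bsub>G i\<^esub> then w else (i, g \<otimes>\<^bsub>G i\<^esub> h) # w)
      else (i, g) # (j, h) # w)"

definition free_product :: "'i set \<Rightarrow> ('i \<Rightarrow> ('a, 'm) monoid_scheme) \<Rightarrow> ('i \<times> 'a) list monoid" where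
  "free_product I G =
     \<lparr>carrier = {w. (\<forall>(i, g) \<in> set w. i \<in> I \<and> g \<in> carrier (G i) \<and> g \<noteq> \<one>\<^bsub>G i\<^esub>) \<and>
                    successively (\<lambda>(i, g) (j, h). i \<noteq> j) w},
      monoid.mult = foldr (syllable_cons G),
      one = []\<rparr>"


section \<open>Symmetric outer automorphisms\<close>

definition inner_auto :: "('a, 'm) monoid_scheme \<Rightarrow> ('a \<Rightarrow> 'a) set" where
  "inner_auto G = (\<lambda>g. \<lambda>x\<in>carrier G. g \<otimes>\<^bsub>G\<^esub> x \<otimes>\<^bsub>G\<^esub> inv\<^bsub>G\<^esub> g) ` carrier G"

definition OutGroup :: "('a, 'm) monoid_scheme \<Rightarrow> ('a \<Rightarrow> 'a) set monoid" where
  "OutGroup G = AutoGroup G Mod inner_auto G"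

definition out_class :: "('a, 'm) monoid_scheme \<Rightarrow> ('a \<Rightarrow> 'a) \<Rightarrow> ('a \<Rightarrow> 'a) set" where
  "out_class G \<phi> = inner_auto G #>\<^bsub>AutoGroup G\<^esub> \<phi>"

definition sym_auto :: "('a, 'm) monoid_scheme \<Rightarrow> 'a set \<Rightarrow> ('a \<Rightarrow> 'a) set" where
  "sym_auto G S =
     {\<phi> \<in> auto G. \<forall>s\<in>S. \<exists>g\<in>carrier G. \<exists>t\<in>S.
        \<phi> s = g \<otimes>\<^bsub>G\<^esub> t \<otimes>\<^bsub>G\<^esub> inv\<^bsub>G\<^esub> g \<or> \<phi> s = g \<otimes>\<^bsub>G\<^esub> inv\<^bsub>G\<^esub> t \<otimes>\<^bsub>G\<^esub> inv\<^bsub>G\<^esub> g}"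

definition SymOut :: "('a, 'm) monoid_scheme \<Rightarrow> 'a set \<Rightarrow> ('a \<Rightarrow> 'a) set monoid" where
  "SymOut G S = OutGroup G \<lparr>carrier := out_class G ` sym_auto G S\<rparr>"

definition normal_closure :: "('a, 'm) monoid_scheme \<Rightarrow> 'a set \<Rightarrow> 'a set" where
  "normal_closure G S = \<Inter> {N. normal N G \<and> S \<subseteq> N}"

text \<open>If \<open>p\<close> maps \<open>G\<close> onto \<open>H\<close> and the endomorphism \<open>\<phi>\<close> of \<open>G\<close> preserves the kernel of \<open>p\<close>, then
  the image set below is a singleton, and the value is the endomorphism of \<open>H\<close> induced by \<open>\<phi>\<close>.\<close>

definition induced_map ::
  "('a, 'm) monoid_scheme \<Rightarrow> ('b, 'k) monoid_scheme \<Rightarrow> ('a \<Rightarrow> 'b) \<Rightarrow> ('a \<Rightarrow> 'a) \<Rightarrow> ('b \<Rightarrow> 'b)" where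
  "induced_map G H p \<phi> = (\<lambda>z\<in>carrier H. the_elem ((\<lambda>x. p (\<phi> x)) ` {x \<in> carrier G. p x = z}))"


section \<open>The groups \<open>F\<^sub>n\<close> and \<open>H\<^sub>n\<close>\<close>

abbreviation Fn :: "nat \<Rightarrow> (nat \<times> bool) list monoid" where
  "Fn n \<equiv> free_group {1..n}"

abbreviation ygen :: "nat \<Rightarrow> (nat \<times> bool) list" where
  "ygen i \<equiv> free_gen i"

definition Hn :: "nat \<Rightarrow> (nat \<times> int) list monoid" where
  "Hn n = free_product {1..n} (\<lambda>_. integer_mod_group 2)"

definition zgen :: "nat \<Rightarrow> (nat \<times> int) list" where
  "zgen i = [(i, 1)]"

definition pi_map :: "nat \<Rightarrow> (nat \<times> bool) list \<Rightarrow> (nat \<times> int) list" where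
  "pi_map n = free_lift (Hn n) zgen"

abbreviation SymOut_F :: "nat \<Rightarrow> ((nat \<times> bool) list \<Rightarrow> (nat \<times> bool) list) set monoid" where
  "SymOut_F n \<equiv> SymOut (Fn n) (ygen ` {1..n})"

abbreviation SymOut_H :: "nat \<Rightarrow> ((nat \<times> int) list \<Rightarrow> (nat \<times> int) list) set monoid" where
  "SymOut_H n \<equiv> SymOut (Hn n) (zgen ` {1..n})"

text \<open>All representatives in an outer class induce automorphisms of \<open>Hn n\<close> of the same outer class,
  so the image set below is a singleton for every element of \<open>SymOut_F n\<close>.\<close>

definition P_map :: "nat \<Rightarrow> ((nat \<times> bool) list \<Rightarrow> (nat \<times> bool) list) set
                     \<Rightarrow> ((nat \<times> int) list \<Rightarrow> (nat \<times> int) list) set" where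
  "P_map n C = the_elem ((\<lambda>\<phi>. out_class (Hn n) (induced_map (Fn n) (Hn n) (pi_map n) \<phi>)) ` C)"

definition rho :: "nat \<Rightarrow> nat \<Rightarrow> ((nat \<times> bool) list \<Rightarrow> (nat \<times> bool) list) set" where
  "rho n i = out_class (Fn n)
     (\<lambda>w\<in>carrier (Fn n). free_lift (Fn n) (\<lambda>j. if j = i then inv\<^bsub>Fn n\<^esub> (ygen j) else ygen j) w)"


section \<open>Basic facts\<close>

lemma successively_Cons_iff:
  "successively R (x # w) \<longleftrightarrow> (w = [] \<or> R x (hd w)) \<and> successively R w"
  by (cases w) auto

lemma free_cons_closed:
  assumes "fst x \<in> I" "w \<in> carrier (free_group I)"
  shows "free_cons x w \<in> carrier (free_group I)"
  using assms
  by (induction x w rule: free_cons.induct)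
     (auto simp: free_group_def freely_reduced_def successively_Cons_iff)

lemma free_cons_cancel:
  assumes "freely_reduced w"
  shows "free_cons (i, \<not> b) (free_cons (i, b) w) = w"
  using assms
  by (cases w rule: remdups_adj.cases)
     (auto simp: freely_reduced_def)

lemma free_cons_reduced:
  assumes "freely_reduced (x # w)"
  shows "free_cons x w = x # w"
  using assms by (cases x; cases w) (auto simp: freely_reduced_def)

lemma free_mult_closed:
  assumes "fst ` set u \<subseteq> I" "v \<in> carrier (free_group I)"
  shows "foldr free_cons u v \<in> carrier (free_group I)"
  using assms by (induction u) (auto intro: free_cons_closed)

lemma carrier_free_group_iff:
  "w \<in> carrier (free_group I) \<longleftrightarrow> fst ` set w \<subseteq> I \<and> freely_reduced w"
  by (simp add: free_group_def)

lemma free_mult_cons: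
  assumes "freely_reduced v" "freely_reduced w"
  shows "foldr free_cons (free_cons x v) w = free_cons x (foldr free_cons v w)"
proof (cases v)
  case (Cons y v')
  obtain i b j c where xy: "x = (i, b)" "y = (j, c)" by (cases x; cases y) auto
  have "freely_reduced (foldr free_cons v' w)"
    using free_mult_closed[of v' UNIV w] assms by (simp add: carrier_free_group_iff)
  then show ?thesis
    using free_cons_cancel[of "foldr free_cons v' w" j c] by (auto simp: xy Cons)
qed simp

lemma group_free_group: "group (free_group I)"
proof -
  let ?F = "free_group I"
  have m: "x \<otimes>\<^bsub>?F\<^esub> y = foldr free_cons x y" for x y by (simp add: free_group_def)
  have o: "\<one>\<^bsub>?F\<^esub> = []" by (simp add: free_group_def)
  have cl: "x \<otimes>\<^bsub>?F\<^esub> y \<in> carrier ?F" if "x \<in> carrier ?F" "y \<in> carrier ?F" for x y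
    using that free_mult_closed[of x I y] by (simp add: m carrier_free_group_iff)
  have tl: "w \<in> carrier ?F" "fst a \<in> I" if "a # w \<in> carrier ?F" for a w
    using that by (auto simp: carrier_free_group_iff freely_reduced_def successively_Cons_iff)
  have assoc: "(x \<otimes>\<^bsub>?F\<^esub> y) \<otimes>\<^bsub>?F\<^esub> w = x \<otimes>\<^bsub>?F\<^esub> (y \<otimes>\<^bsub>?F\<^esub> w)"
    if "x \<in> carrier ?F" "y \<in> carrier ?F" "w \<in> carrier ?F" for x y w
    using that(1)
  proof (induction x)
    case (Cons a x)
    have "x \<otimes>\<^bsub>?F\<^esub> y \<in> carrier ?F" using cl tl Cons.prems that by blast
    then show ?case
      using Cons that tl(1)[OF Cons.prems]
      by (simp add: m free_mult_cons carrier_free_group_iff)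
  qed (simp add: m)
  have inv: "\<exists>y\<in>carrier ?F. y \<otimes>\<^bsub>?F\<^esub> x = \<one>\<^bsub>?F\<^esub>" if "x \<in> carrier ?F" for x
    using that
  proof (induction x)
    case Nil
    then show ?case by (intro bexI[of _ "[]"]) (simp_all add: m o carrier_free_group_iff freely_reduced_def)
  next
    case (Cons a x)
    obtain i b where a: "a = (i, b)" by (cases a)
    obtain v where v: "v \<in> carrier ?F" "v \<otimes>\<^bsub>?F\<^esub> x = \<one>\<^bsub>?F\<^esub>"
      using Cons tl by blast
    have c: "[(i, \<not> b)] \<in> carrier ?F"
      using tl(2)[OF Cons.prems] by (simp add: a carrier_free_group_iff freely_reduced_def)
    have "free_cons (i, \<not> b) (a # x) = x" by (simp add: a)
    then have "v \<otimes>\<^bsub>?F\<^esub> [(i, \<not> b)] \<otimes>\<^bsub>?F\<^esub> (a # x) = \<one>\<^bsub>?F\<^esub>"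
      using assoc[OF v(1) c Cons.prems] v(2) by (simp add: m)
    then show ?case using cl[OF v(1) c] by blast
  qed
  show ?thesis
    by (rule groupI) (use cl assoc inv in \<open>auto simp: m o carrier_free_group_iff freely_reduced_def\<close>)
qed

lemma free_gen_carrier: "i \<in> I \<Longrightarrow> free_gen i \<in> carrier (free_group I)"
  by (simp add: carrier_free_group_iff free_gen_def freely_reduced_def)

lemma free_lift_gen:
  assumes "group G" "f i \<in> carrier G"
  shows "free_lift G f (free_gen i) = f i"
  using assms by (simp add: free_lift_def free_gen_def group.is_monoid monoid.r_one)

lemma free_lift_hom:
  assumes "group G" and f: "\<And>i. i \<in> I \<Longrightarrow> f i \<in> carrier G"
  shows "free_lift G f \<in> hom (free_group I) G"
proof -
  interpret group G by fact
  let ?l = "free_lift G f"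
  have cl: "?l u \<in> carrier G" if "fst ` set u \<subseteq> I" for u
    using that by (induction u) (auto simp: free_lift_def f)
  have c: "?l (free_cons x w) = ?l (x # w)" if "fst ` set (x # w) \<subseteq> I" for x w
    using that
  proof (induction x w rule: free_cons.induct)
    case (2 i b j c w)
    then show ?case
      using cl[of w] f[of j]
      by (auto simp: free_lift_def m_assoc[symmetric])
  qed simp
  have "?l (foldr free_cons u v) = ?l u \<otimes>\<^bsub>G\<^esub> ?l v"
    if "fst ` set u \<subseteq> I" "v \<in> carrier (free_group I)" for u v
    using that
  proof (induction u)
    case Nil
    then show ?case using cl[of v] by (simp add: free_lift_def carrier_free_group_iff)
  next
    case (Cons x u)
    obtain i b where x: "x = (i, b)" by (cases x)
    have "foldr free_cons u v \<in> carrier (free_group I)"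
      using Cons.prems by (intro free_mult_closed) auto
    then have "?l (foldr free_cons (x # u) v) = ?l (x # foldr free_cons u v)"
      using Cons.prems by (simp add: c carrier_free_group_iff)
    also have "\<dots> = ?l (x # u) \<otimes>\<^bsub>G\<^esub> ?l v"
      using Cons cl[of u] cl[of v] f[of i]
      by (auto simp: x free_lift_def m_assoc carrier_free_group_iff)
    finally show ?case .
  qed
  then show ?thesis
    using cl by (intro homI) (auto simp: carrier_free_group_iff, simp add: free_group_def)
qed

lemma carrier_free_product_Cons:
  "(i, g) # w \<in> carrier (free_product I G) \<longleftrightarrow>
     i \<in> I \<and> g \<in> carrier (G i) \<and> g \<noteq> \<one>\<^bsub>G i\<^esub> \<and> (w = [] \<or> fst (hd w) \<noteq> i) \<and>
     w \<in> carrier (free_product I G)"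
  by (auto simp: free_product_def successively_Cons_iff case_prod_beta)

lemma Nil_in_free_product: "[] \<in> carrier (free_product I G)"
  by (simp add: free_product_def)

lemma syllable_cons_one: "syllable_cons G (i, \<one>\<^bsub>G i\<^esub>) w = w"
  by (cases w) auto

lemma syllable_cons_reduced:
  "(i, g) # w \<in> carrier (free_product I G) \<Longrightarrow> syllable_cons G (i, g) w = (i, g) # w"
  by (cases w) (auto simp: carrier_free_product_Cons)

lemma syllable_cons_closed:
  assumes "\<And>i. i \<in> I \<Longrightarrow> group (G i)"
    and "i \<in> I" "g \<in> carrier (G i)" "w \<in> carrier (free_product I G)"
  shows "syllable_cons G (i, g) w \<in> carrier (free_product I G)"
proof -
  interpret group "G i" using assms by blast
  show ?thesis
    using assms(2-)
    by (cases w) (auto simp: carrier_free_product_Cons Nil_in_free_product)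
qed

lemma syllable_cons_cons:
  assumes "\<And>i. i \<in> I \<Longrightarrow> group (G i)"
    and "i \<in> I" "g \<in> carrier (G i)" "h \<in> carrier (G i)" "w \<in> carrier (free_product I G)"
  shows "syllable_cons G (i, g) (syllable_cons G (i, h) w) = syllable_cons G (i, g \<otimes>\<^bsub>G i\<^esub> h) w"
proof -
  interpret group "G i" using assms by blast
  have red: "syllable_cons G (i, k) w' = (if k = \<one>\<^bsub>G i\<^esub> then w' else (i, k) # w')"
    if "w' = [] \<or> fst (hd w') \<noteq> i" for k w'
    using that by (cases w') auto
  show ?thesis
  proof (cases "w = [] \<or> fst (hd w) \<noteq> i")
    case True
    then show ?thesis using assms(2-4) by (auto simp: red)
  next
    case False
    then obtain k w' where w: "w = (i, k) # w'" by (cases w) auto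
    have k: "k \<in> carrier (G i)" "k \<noteq> \<one>\<^bsub>G i\<^esub>" "w' = [] \<or> fst (hd w') \<noteq> i"
      using assms(5) by (auto simp: w carrier_free_product_Cons)
    have step: "syllable_cons G (i, a) w = syllable_cons G (i, a \<otimes>\<^bsub>G i\<^esub> k) w'"
      if "a \<in> carrier (G i)" for a
      using that k by (auto simp: w red)
    have "syllable_cons G (i, g) (syllable_cons G (i, b) w') = syllable_cons G (i, g \<otimes>\<^bsub>G i\<^esub> b) w'"
      if "b \<in> carrier (G i)" for b
      using that k assms(3) by (auto simp: red)
    then show ?thesis
      using assms(3,4) k by (simp add: step m_assoc)
  qed
qed

lemma group_free_product:
  assumes G: "\<And>i. i \<in> I \<Longrightarrow> group (G i)"
  shows "group (free_product I G)"
proof -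
  let ?F = "free_product I G"
  have m: "x \<otimes>\<^bsub>?F\<^esub> y = foldr (syllable_cons G) x y" for x y by (simp add: free_product_def)
  have o: "\<one>\<^bsub>?F\<^esub> = []" by (simp add: free_product_def)
  have cl: "x \<otimes>\<^bsub>?F\<^esub> y \<in> carrier ?F" if "x \<in> carrier ?F" "y \<in> carrier ?F" for x y
    using that
    by (induction x) (auto simp: m carrier_free_product_Cons intro!: syllable_cons_closed G)
  have mc: "foldr (syllable_cons G) (syllable_cons G (i, g) v) w
              = syllable_cons G (i, g) (foldr (syllable_cons G) v w)"
    if "i \<in> I" "g \<in> carrier (G i)" "v \<in> carrier ?F" "w \<in> carrier ?F" for i g v w
  proof (cases v)
    case Nil
    then show ?thesis by (simp add: syllable_cons_one)
  next
    case (Cons a v')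
    obtain j h where a: "a = (j, h)" by (cases a)
    have v': "j \<in> I" "h \<in> carrier (G j)" "v' \<in> carrier ?F"
      using that by (auto simp: a Cons carrier_free_product_Cons)
    then have "foldr (syllable_cons G) v' w \<in> carrier ?F"
      using cl that by (simp add: m)
    then show ?thesis
      using that v' syllable_cons_cons[of I G i g h "foldr (syllable_cons G) v' w"]
      by (auto simp: a Cons G syllable_cons_one)
  qed
  have assoc: "(x \<otimes>\<^bsub>?F\<^esub> y) \<otimes>\<^bsub>?F\<^esub> w = x \<otimes>\<^bsub>?F\<^esub> (y \<otimes>\<^bsub>?F\<^esub> w)"
    if "x \<in> carrier ?F" "y \<in> carrier ?F" "w \<in> carrier ?F" for x y w
    using that(1)
  proof (induction x)
    case (Cons a x)
    obtain i g where a: "a = (i, g)" by (cases a)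
    have x: "i \<in> I" "g \<in> carrier (G i)" "x \<in> carrier ?F"
      using Cons.prems by (auto simp: a carrier_free_product_Cons)
    then have "x \<otimes>\<^bsub>?F\<^esub> y \<in> carrier ?F" using cl that by blast
    then show ?case
      using Cons that x by (simp add: a m mc)
  qed (simp add: m)
  have inv: "\<exists>y\<in>carrier ?F. y \<otimes>\<^bsub>?F\<^esub> x = \<one>\<^bsub>?F\<^esub>" if "x \<in> carrier ?F" for x
    using that
  proof (induction x)
    case Nil
    then show ?case by (intro bexI[of _ "[]"]) (simp_all add: m o Nil_in_free_product)
  next
    case (Cons a x)
    obtain i g where a: "a = (i, g)" by (cases a)
    have x: "i \<in> I" "g \<in> carrier (G i)" "g \<noteq> \<one>\<^bsub>G i\<^esub>" "x \<in> carrier ?F"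
      using Cons.prems by (auto simp: a carrier_free_product_Cons)
    interpret group "G i" using G x by blast
    obtain v where v: "v \<in> carrier ?F" "v \<otimes>\<^bsub>?F\<^esub> x = \<one>\<^bsub>?F\<^esub>"
      using Cons x by blast
    have c: "[(i, inv\<^bsub>G i\<^esub> g)] \<in> carrier ?F"
      using x by (auto simp: carrier_free_product_Cons Nil_in_free_product inv_eq_1_iff)
    have "syllable_cons G (i, inv\<^bsub>G i\<^esub> g) (a # x) = x"
      using x by (simp add: a inv_eq_1_iff)
    then have "v \<otimes>\<^bsub>?F\<^esub> [(i, inv\<^bsub>G i\<^esub> g)] \<otimes>\<^bsub>?F\<^esub> (a # x) = \<one>\<^bsub>?F\<^esub>"
      using assoc[OF v(1) c Cons.prems] v(2) by (simp add: m)
    then show ?case using cl[OF v(1) c] by blast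
  qed
  show ?thesis
    by (rule groupI) (use cl assoc inv in \<open>auto simp: o Nil_in_free_product, simp add: m\<close>)
qed

lemma group_Hn: "group (Hn n)"
  unfolding Hn_def by (rule group_free_product) simp

lemma zgen_carrier: "i \<in> {1..n} \<Longrightarrow> zgen i \<in> carrier (Hn n)"
  by (simp add: Hn_def zgen_def carrier_free_product_Cons Nil_in_free_product integer_mod_group_def)

lemma zgen_order_two: "zgen i \<otimes>\<^bsub>Hn n\<^esub> zgen i = \<one>\<^bsub>Hn n\<^esub>" "zgen i \<noteq> \<one>\<^bsub>Hn n\<^esub>"
  by (simp_all add: Hn_def zgen_def free_product_def integer_mod_group_def)

lemma pi_map_hom: "pi_map n \<in> hom (Fn n) (Hn n)"
  unfolding pi_map_def by (rule free_lift_hom) (auto simp: group_Hn zgen_carrier simp del: atLeastAtMost_iff)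

lemma pi_map_gen: "i \<in> {1..n} \<Longrightarrow> pi_map n (ygen i) = zgen i"
  unfolding pi_map_def by (rule free_lift_gen) (auto simp: group_Hn zgen_carrier simp del: atLeastAtMost_iff)

end

theory Submission
  imports Defs "HOL-Library.Sublist"
begin

text \<open>The easy inclusion: each \<open>\<rho>\<^sub>i\<close> induces the identity on \<open>H\<^sub>n\<close>, and kernels are normal.
For the other one let \<open>N\<close> be a normal subgroup of \<open>SymOut(F\<^sub>n)\<close> that contains all \<open>\<rho>\<^sub>i\<close>. An outer
class in the kernel has a representative \<open>\<phi>\<close> that induces the identity on \<open>H\<^sub>n\<close>, since inner
automorphisms of \<open>H\<^sub>n\<close> lift along the surjection \<open>\<pi>\<close>; counting generators mod 2 shows that
\<open>\<phi>\<close> maps every \<open>y\<^sub>i\<close> to a conjugate of \<open>y\<^sub>i\<close> or of its inverse. It remains to see that the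
class of \<open>\<phi>\<close> is in \<open>N\<close>.

Such a \<open>\<phi>\<close> is a product of inversions of generators and of partial conjugations
\<open>\<chi>\<^sub>i\<^sub>j : y\<^sub>i \<mapsto> y\<^sub>j y\<^sub>i y\<^sub>j\<inverse>\<close> and their inverses (\<open>pure_reach\<close>): if no partial conjugation shortens the
images of the generators, then these images play ping-pong in the Cayley tree, and \<open>\<phi>\<close> can
only be surjective if it maps each generator to itself or its inverse.

The inversion of \<open>y\<^sub>j\<close> conjugates \<open>\<chi>\<^sub>i\<^sub>j\<close> to its inverse, so \<open>\<chi>\<^sub>i\<^sub>j\<^sup>2\<close> is in \<open>N\<close>, and modulo \<open>N\<close> the
automorphism \<open>\<phi>\<close> is a product of the \<open>\<chi>\<^sub>i\<^sub>j\<close> alone. Why is this product trivial modulo \<open>N\<close>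
if it is trivial on \<open>H\<^sub>n\<close>? Read it as a path from the identity and let the rank of a
vertex be the total length of the images of the generators in \<open>H\<^sub>n\<close>. On \<open>H\<^sub>n\<close> the image of
\<open>y\<^sub>i\<close> is an involution \<open>w\<^sub>i\<close> that flips one edge of the Cayley tree, and \<open>\<chi>\<^sub>i\<^sub>j\<close> replaces \<open>w\<^sub>i\<close> by
\<open>w\<^sub>j w\<^sub>i w\<^sub>j\<close>. The rank goes down if the edge of \<open>w\<^sub>i\<close> lies behind the edge of \<open>w\<^sub>j\<close>, as seen from
the base point, and goes up otherwise; it never stays the same (\<open>rank_descent\<close>). Two
descents from one vertex can be joined below it by relations that hold already in
\<open>Aut(F\<^sub>n)\<close>, namely

  \<open>\<chi>\<^sub>i\<^sub>j \<chi>\<^sub>k\<^sub>l = \<chi>\<^sub>k\<^sub>l \<chi>\<^sub>i\<^sub>j\<close> for \<open>i \<noteq> k, i \<noteq> l, j \<noteq> k\<close> (\<open>pc_commute\<close>) and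
  \<open>\<chi>\<^sub>i\<^sub>j \<chi>\<^sub>l\<^sub>j \<chi>\<^sub>i\<^sub>l = \<chi>\<^sub>i\<^sub>l \<chi>\<^sub>i\<^sub>j \<chi>\<^sub>l\<^sub>j\<close> (\<open>pc_triple\<close>),

together with the triviality of the squares modulo \<open>N\<close> (\<open>peak_joined\<close>). Hence all peaks of a
closed path can be removed until nothing is left of the path, and so \<open>\<phi>\<close> is trivial modulo
\<open>N\<close> (\<open>connected_imp_mem\<close>).\<close>

(* otherwise simp rewrites the index set inside Fn n to {Suc 0..n} *)
declare One_nat_def [simp del]

section \<open>Reduced words over an alphabet with inverses\<close>

text \<open>The free group and the free product of groups of order two both consist of the words in which
no letter is followed by its inverse. They differ in the formal inverse \<open>\<iota>\<close> of a letter only,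
which flips the sign in the first case and is the identity in the second. The geometry of the
Cayley tree can therefore be treated for both at once.\<close>

locale word_group = group G for G :: "('a list, 'm) monoid_scheme" (structure) +
  fixes S :: "'a set" and \<iota> :: "'a \<Rightarrow> 'a"
  assumes carrier_eq: "carrier G = {w. set w \<subseteq> S \<and> successively (\<lambda>x y. y \<noteq> \<iota> x) w}"
    and one_eq: "\<one> = []"
    and iota_closed: "x \<in> S \<Longrightarrow> \<iota> x \<in> S"
    and iota_iota [simp]: "\<iota> (\<iota> x) = x"
    and Cons_mult: "x # w \<in> carrier G \<Longrightarrow> [x] \<otimes> w = x # w"
    and letter_cancel: "x \<in> S \<Longrightarrow> [x] \<otimes> [\<iota> x] = \<one>"
begin

lemma Nil_in_carrier [simp]: "[] \<in> carrier G"
  by (simp add: carrier_eq)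

lemma iota_eq_iff [simp]: "\<iota> x = \<iota> y \<longleftrightarrow> x = y"
  by (metis iota_iota)

lemma iota_in_iff [simp]: "\<iota> x \<in> S \<longleftrightarrow> x \<in> S"
  using iota_closed[of x] iota_closed[of "\<iota> x"] by auto

lemma iota_eq_swap: "\<iota> x = y \<longleftrightarrow> x = \<iota> y"
  by auto

lemma letter_in_carrier: "[x] \<in> carrier G \<longleftrightarrow> x \<in> S"
  by (simp add: carrier_eq)

lemma carrier_Cons_iff:
  "x # w \<in> carrier G \<longleftrightarrow> x \<in> S \<and> w \<in> carrier G \<and> (w = [] \<or> hd w \<noteq> \<iota> x)"
  by (auto simp: carrier_eq successively_Cons_iff)

lemma carrier_append_iff:
  "u @ v \<in> carrier G \<longleftrightarrow>
     u \<in> carrier G \<and> v \<in> carrier G \<and> (u = [] \<or> v = [] \<or> hd v \<noteq> \<iota> (last u))"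
  by (auto simp: carrier_eq successively_append_iff)

lemma append_mult: "u @ v \<in> carrier G \<Longrightarrow> u \<otimes> v = u @ v"
proof (induction u)
  case Nil
  then show ?case using one_eq l_one by force
next
  case (Cons x u)
  then have uv: "x # (u @ v) \<in> carrier G" and u: "u @ v \<in> carrier G" "x # u \<in> carrier G"
    using carrier_append_iff[of "x # u" v] by (simp_all add: carrier_Cons_iff[of x "u @ v"])
  have c: "[x] \<in> carrier G" "u \<in> carrier G" "v \<in> carrier G"
    using u by (auto simp: carrier_Cons_iff carrier_append_iff letter_in_carrier)
  have "(x # u) \<otimes> v = [x] \<otimes> (u \<otimes> v)"
    using Cons_mult[OF u(2)] c m_assoc by metis
  then show ?case using Cons.IH[OF u(1)] Cons_mult[OF uv] by simp
qed

lemma inv_letter: "x \<in> S \<Longrightarrow> inv [x] = [\<iota> x]"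
  by (rule inv_equality) (use letter_cancel[of "\<iota> x"] in \<open>auto simp: letter_in_carrier iota_closed\<close>)

lemma letter_cancel_left: 
  assumes "x \<in> S" "w \<in> carrier G"
  shows "[\<iota> x] \<otimes> ([x] \<otimes> w) = w" "[x] \<otimes> ([\<iota> x] \<otimes> w) = w"
  using assms letter_cancel[of "\<iota> x"] letter_cancel[of x]
  by (simp_all add: m_assoc[symmetric] letter_in_carrier iota_closed)

lemma length_letter_mult:
  assumes "x \<in> S" "w \<in> carrier G"
  shows "length ([x] \<otimes> w) \<le> Suc (length w)"
proof (cases "x # w \<in> carrier G")
  case True
  then show ?thesis by (simp add: Cons_mult)
next
  case False
  then obtain v where w: "w = \<iota> x # v"
    using assms by (cases w) (auto simp: carrier_Cons_iff)
  then have "w = [\<iota> x] \<otimes> v" "v \<in> carrier G"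
    using assms Cons_mult[of "\<iota> x" v] by (auto simp: carrier_Cons_iff)
  then have "[x] \<otimes> w = v" using assms letter_cancel_left by simp
  then show ?thesis by (simp add: w)
qed

lemma length_mult: "u \<in> carrier G \<Longrightarrow> v \<in> carrier G \<Longrightarrow> length (u \<otimes> v) \<le> length u + length v"
proof (induction u)
  case Nil
  then show ?case using one_eq by (metis l_one le_add2)
next
  case (Cons x u)
  then have c: "x \<in> S" "u \<in> carrier G" by (auto simp: carrier_Cons_iff)
  then have "(x # u) \<otimes> v = [x] \<otimes> (u \<otimes> v)"
    using Cons_mult[OF Cons.prems(1)] Cons.prems(2) m_assoc letter_in_carrier by metis
  then show ?case
    using length_letter_mult[of x "u \<otimes> v"] Cons c by simp
qed

lemma inv_word: "u \<in> carrier G \<Longrightarrow> inv u = rev (map \<iota> u)"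
proof (induction u)
  case Nil
  then show ?case using one_eq inv_one by simp
next
  case (Cons x u)
  then have c: "x \<in> S" "u \<in> carrier G" "[x] \<in> carrier G" "u = [] \<or> hd u \<noteq> \<iota> x"
    by (auto simp: carrier_Cons_iff letter_in_carrier)
  have i: "rev (map \<iota> u) \<in> carrier G" using Cons.IH c by (metis inv_closed)
  have "last (rev (map \<iota> u)) = \<iota> (hd u)" if "u \<noteq> []"
    using that by (simp add: last_rev hd_map)
  then have r: "rev (map \<iota> u) @ [\<iota> x] \<in> carrier G"
    using i c by (auto simp: carrier_append_iff letter_in_carrier iota_closed)
  have "inv (x # u) = inv ([x] \<otimes> u)" using Cons_mult Cons.prems by simp
  also have "\<dots> = inv u \<otimes> [\<iota> x]" using c by (simp add: inv_mult_group inv_letter)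
  also have "\<dots> = rev (map \<iota> (x # u))" using Cons.IH c append_mult[OF r] by simp
  finally show ?case .
qed

lemma length_inv: "u \<in> carrier G \<Longrightarrow> length (inv u) = length u"
  by (simp add: inv_word)

definition conj_letter :: "'a list \<Rightarrow> 'a \<Rightarrow> 'a list" where
  "conj_letter g x = g \<otimes> [x] \<otimes> inv g"

lemma conj_letter_closed: "g \<in> carrier G \<Longrightarrow> x \<in> S \<Longrightarrow> conj_letter g x \<in> carrier G"
  by (simp add: conj_letter_def letter_in_carrier)

lemma inv_conj_letter: "g \<in> carrier G \<Longrightarrow> x \<in> S \<Longrightarrow> inv (conj_letter g x) = conj_letter g (\<iota> x)"
  by (simp add: conj_letter_def letter_in_carrier inv_mult_group inv_letter m_assoc iota_closed)

lemma conj_conj_letter: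
  "h \<in> carrier G \<Longrightarrow> g \<in> carrier G \<Longrightarrow> x \<in> S \<Longrightarrow>
     h \<otimes> conj_letter g x \<otimes> inv h = conj_letter (h \<otimes> g) x"
  by (simp add: conj_letter_def letter_in_carrier inv_mult_group m_assoc)

lemma length_conj_letter_le:
  assumes "g \<in> carrier G" "x \<in> S"
  shows "length (conj_letter g x) \<le> 2 * length g + 1"
proof -
  have "length (g \<otimes> [x] \<otimes> inv g) \<le> length (g \<otimes> [x]) + length (inv g)"
    using assms by (intro length_mult) (auto simp: letter_in_carrier)
  also have "length (g \<otimes> [x]) \<le> length g + 1"
    using length_mult[of g "[x]"] assms by (auto simp: letter_in_carrier)
  finally show ?thesis using assms by (simp add: conj_letter_def length_inv)
qed

text \<open>A stem of \<open>x\<close> ends neither in \<open>x\<close> nor in its inverse, so that \<open>b x b\<inverse>\<close> is reduced as it stands.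
In the Cayley tree, \<open>b\<close> is the end closer to the base point of the edge from \<open>b\<close> to \<open>b x\<close>, and the
words with prefix \<open>b x\<close> form the half of the tree behind this edge.\<close>

definition stem :: "'a list \<Rightarrow> 'a \<Rightarrow> bool" where
  "stem b x \<longleftrightarrow> b @ [x] \<in> carrier G \<and> b @ [\<iota> x] \<in> carrier G"

lemma stemD: "stem b x \<Longrightarrow> b \<in> carrier G" "stem b x \<Longrightarrow> x \<in> S" "stem b x \<Longrightarrow> stem b (\<iota> x)"
  by (auto simp: stem_def carrier_append_iff letter_in_carrier)

lemma stem_iff: "stem b x \<longleftrightarrow> b \<in> carrier G \<and> x \<in> S \<and> (b = [] \<or> last b \<noteq> x \<and> last b \<noteq> \<iota> x)"
  using iota_eq_swap[of x "last b"]
  by (auto simp: stem_def carrier_append_iff letter_in_carrier)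

lemma conj_letter_stem:
  assumes "stem b x"
  shows "conj_letter b x = b @ [x] @ rev (map \<iota> b)"
proof -
  have c: "b @ [x] \<in> carrier G" "b \<in> carrier G" using assms stemD(1)[OF assms] by (simp_all add: stem_def)
  have i: "rev (map \<iota> b) \<in> carrier G" using c inv_word by (metis inv_closed)
  have "hd (rev (map \<iota> b)) = \<iota> (last b)" if "b \<noteq> []"
    using that by (simp add: hd_rev last_map)
  then have r: "(b @ [x]) @ rev (map \<iota> b) \<in> carrier G"
    using c i assms
    by (subst carrier_append_iff) (auto simp: stem_iff)
  show ?thesis
    using append_mult[OF c(1)] append_mult[OF r] c by (simp add: conj_letter_def inv_word)
qed

lemma length_conj_letter_stem: "stem b x \<Longrightarrow> length (conj_letter b x) = 2 * length b + 1"
  by (simp add: conj_letter_stem)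

text \<open>Letters \<open>x\<close> and \<open>\<iota> x\<close> at the end of \<open>g\<close> commute with \<open>x\<close> and can be stripped. Stripping stops before
any other letter, which is why prefixes that end in another letter survive.\<close>

lemma stem_exists:
  assumes "x \<in> S" "g \<in> carrier G"
  obtains b where "stem b x" "conj_letter b x = conj_letter g x"
    "\<And>p y. y \<noteq> x \<Longrightarrow> y \<noteq> \<iota> x \<Longrightarrow> prefix (p @ [y]) g \<Longrightarrow> prefix (p @ [y]) b"
proof -
  have "\<exists>b. stem b x \<and> conj_letter b x = conj_letter g x \<and>
    (\<forall>p y. y \<noteq> x \<longrightarrow> y \<noteq> \<iota> x \<longrightarrow> prefix (p @ [y]) g \<longrightarrow> prefix (p @ [y]) b)"
    using assms(2)
  proof (induction g rule: rev_induct)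
    case Nil
    then show ?case using assms(1) by (intro exI[of _ "[]"]) (auto simp: stem_iff)
  next
    case (snoc z g)
    show ?case
    proof (cases "z = x \<or> z = \<iota> x")
      case True
      have c: "g \<in> carrier G" "[x] \<in> carrier G" "z \<in> S" "[z] \<in> carrier G"
        using snoc.prems assms(1) by (auto simp: carrier_append_iff letter_in_carrier)
      have zx: "[z] \<otimes> [x] \<otimes> inv [z] = [x]"
        using True c assms(1) letter_cancel[of x] letter_cancel[of "\<iota> x"]
        by (auto simp: inv_letter m_assoc letter_in_carrier letter_cancel_left)
      have "conj_letter (g @ [z]) x = conj_letter (g \<otimes> [z]) x"
        using append_mult snoc.prems by simp
      also have "\<dots> = g \<otimes> ([z] \<otimes> [x] \<otimes> inv [z]) \<otimes> inv g"
        using c by (simp add: conj_letter_def inv_mult_group m_assoc)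
      also have "\<dots> = conj_letter g x" by (simp only: zx conj_letter_def)
      finally show ?thesis using snoc.IH[OF c(1)] True by auto
    next
      case False
      then show ?thesis using snoc.prems assms(1)
        by (intro exI[of _ "g @ [z]"]) (auto simp: stem_iff)
    qed
  qed
  then show ?thesis using that by blast
qed

text \<open>The ping-pong step: \<open>b (\<iota> x) b\<inverse>\<close> carries everything that is not behind the edge from \<open>b\<close> to \<open>b x\<close>
to the half of the tree behind the edge from \<open>b\<close> to \<open>b (\<iota> x)\<close>. For \<open>b = y b'\<close>, translation by
\<open>\<iota> y\<close> reduces the claim to the stem \<open>b'\<close>.\<close>

lemma flip_half_space:
  assumes "stem b x" "t \<in> carrier G" "\<not> prefix (b @ [x]) t"
  shows "prefix (b @ [\<iota> x]) (conj_letter b (\<iota> x) \<otimes> t)"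
  using assms(1)[unfolded stem_def] assms(2-)
proof (induction b arbitrary: t)
  case Nil
  then have "\<iota> x # t \<in> carrier G"
    by (cases t) (auto simp: carrier_Cons_iff letter_in_carrier)
  then have "conj_letter [] (\<iota> x) \<otimes> t = \<iota> x # t"
    using Nil Cons_mult[of "\<iota> x" t]  one_eq inv_one r_one l_one
    by (simp add: conj_letter_def) (metis inv_one l_one r_one)
  then show ?case by simp
next
  case (Cons y b)
  let ?t = "[\<iota> y] \<otimes> t"
  have y: "y \<in> S" "b \<in> carrier G" "\<iota> x \<in> S" "y # b \<in> carrier G"
    and bx: "b @ [x] \<in> carrier G \<and> b @ [\<iota> x] \<in> carrier G"
    using Cons.prems(1) by (auto simp: carrier_Cons_iff carrier_append_iff letter_in_carrier)
  have yc: "[y] \<in> carrier G" "[\<iota> y] \<in> carrier G" "[\<iota> x] \<in> carrier G"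
    using y by (auto simp: letter_in_carrier iota_closed)
  have "\<not> prefix (b @ [x]) ?t"
  proof
    assume p: "prefix (b @ [x]) ?t"
    have "hd (b @ [x]) \<noteq> \<iota> y" using Cons.prems(1) by (auto simp: carrier_Cons_iff)
    then have "?t \<noteq> []" "hd ?t \<noteq> \<iota> y"
      using p by (auto simp: prefix_def hd_append split: if_splits)
    then have "y # ?t \<in> carrier G" using y Cons.prems(2) yc by (simp add: carrier_Cons_iff)
    then have "t = y # ?t" using Cons_mult[of y ?t] letter_cancel_left[OF y(1) Cons.prems(2)] by simp
    then show False using p Cons.prems(3) by (metis Cons_prefix_Cons append_Cons)
  qed
  then have p: "prefix (b @ [\<iota> x]) (conj_letter b (\<iota> x) \<otimes> ?t)" (is "prefix _ ?r")
    using Cons.IH[OF bx] Cons.prems yc by simp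
  have r: "?r \<in> carrier G" using y yc Cons.prems by (simp add: conj_letter_closed)
  have "hd (b @ [\<iota> x]) \<noteq> \<iota> y" using Cons.prems(1) by (auto simp: carrier_Cons_iff)
  then have "y # ?r \<in> carrier G"
    using p r y by (auto simp: carrier_Cons_iff prefix_def hd_append split: if_splits)
  moreover have "conj_letter (y # b) (\<iota> x) \<otimes> t = [y] \<otimes> ?r"
  proof -
    have "y # b = [y] \<otimes> b" using Cons_mult y by simp
    then show ?thesis
      using y yc Cons.prems(2) by (simp add: conj_letter_def inv_mult_group inv_letter m_assoc)
  qed
  ultimately show ?case using p Cons_mult by simp
qed

lemma conj_letter_mult_prefix:
  assumes "b @ [y] @ d \<in> carrier G"
  shows "conj_letter b (\<iota> y) \<otimes> (b @ [y] @ d) = b \<otimes> d"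
proof -
  have c: "b \<in> carrier G" "d \<in> carrier G" "y \<in> S" "[y] @ d \<in> carrier G"
    using assms by (auto simp: carrier_append_iff letter_in_carrier carrier_Cons_iff)
  have "b @ [y] @ d = b \<otimes> ([y] \<otimes> d)"
    using append_mult[OF assms] append_mult[OF c(4)] by simp
  moreover have "inv b \<otimes> (b \<otimes> ([y] \<otimes> d)) = [y] \<otimes> d"
    using c by (simp add: m_assoc[symmetric] letter_in_carrier)
  ultimately show ?thesis
    using c by (simp add: conj_letter_def m_assoc letter_in_carrier letter_cancel_left)
qed

lemma conj_shortens:
  assumes "stem b y" "stem c x" "prefix (b @ [y]) c"
  shows "length (conj_letter (conj_letter b (\<iota> y) \<otimes> c) x) < length (conj_letter c x)"
proof -
  obtain d where d: "c = b @ [y] @ d" using assms(3) by (auto simp: prefix_def)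
  have c: "c \<in> carrier G" "x \<in> S" "b \<in> carrier G" using stemD(1)[OF assms(1)] stemD(1,2)[OF assms(2)] by simp_all
  then have dc: "d \<in> carrier G" by (auto simp: d carrier_append_iff carrier_Cons_iff)
  have "length (conj_letter (b \<otimes> d) x) \<le> 2 * length (b \<otimes> d) + 1"
    using c dc by (intro length_conj_letter_le) auto
  also have "\<dots> < 2 * length c + 1" using length_mult[OF c(3) dc] by (simp add: d)
  finally show ?thesis
    using conj_letter_mult_prefix[of b y d] c length_conj_letter_stem[OF assms(2)] by (simp add: d)
qed

text \<open>After the conjugation the stem lies behind the opposite edge, so conjugating back shortens the
word. The assumptions on the letters keep the stripping of the new stem from undoing the
ping-pong step.\<close>

lemma conj_lengthens:
  assumes b: "stem b y" and c: "stem c x" and "\<not> prefix (b @ [y]) c" "y \<noteq> x" "y \<noteq> \<iota> x"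
  shows "length (conj_letter c x) < length (conj_letter (conj_letter b (\<iota> y) \<otimes> c) x)"
proof -
  let ?r = "conj_letter b (\<iota> y)" let ?s = "conj_letter b y"
  have car: "c \<in> carrier G" "x \<in> S" "b \<in> carrier G" "y \<in> S" "\<iota> y \<in> S"
    using stemD(1,2)[OF b] stemD(1,2)[OF c] by simp_all
  have s: "?s \<in> carrier G" "inv ?s = ?r"
    using conj_letter_closed[OF car(3,4)] inv_conj_letter[OF car(3,4)] by simp_all
  then have rs: "?s \<otimes> ?r = \<one>" "?r \<in> carrier G" "?s \<in> carrier G"
    using r_inv[OF s(1)] inv_closed[OF s(1)] by auto
  have p: "prefix (b @ [\<iota> y]) (?r \<otimes> c)" using flip_half_space b car assms(3) by blast
  have rc: "?r \<otimes> c \<in> carrier G" using car rs by simp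
  obtain c' where c': "stem c' x" "conj_letter c' x = conj_letter (?r \<otimes> c) x"
    and q: "\<And>p z. z \<noteq> x \<Longrightarrow> z \<noteq> \<iota> x \<Longrightarrow> prefix (p @ [z]) (?r \<otimes> c) \<Longrightarrow> prefix (p @ [z]) c'"
    using stem_exists[OF car(2) rc] by blast
  have pc: "prefix (b @ [\<iota> y]) c'"
    using assms(4,5) p iota_eq_swap[of y x] by (intro q) auto
  have c'c: "c' \<in> carrier G" using stemD(1)[OF c'(1)] .
  have "length (conj_letter (?s \<otimes> c') x) < length (conj_letter c' x)"
    using conj_shortens[OF stemD(3)[OF b] c'(1) pc] by simp
  also have "conj_letter (?s \<otimes> c') x = ?s \<otimes> conj_letter (?r \<otimes> c) x \<otimes> inv ?s"
    using c'(2) conj_conj_letter[of ?s c' x] c'c car rs by simp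
  also have "\<dots> = conj_letter (?s \<otimes> (?r \<otimes> c)) x"
    using car rs by (subst conj_conj_letter) auto
  also have "\<dots> = conj_letter c x" using car rs by (simp add: m_assoc[symmetric])
  finally show ?thesis using c' by simp
qed

text \<open>Half trees with a common word are nested; the letters differ, so they are not equal and the
shorter prefix ends within the longer stem.\<close>

lemma prefix_comparable:
  assumes "prefix (b @ [x]) t" "prefix (c @ [y]) t" "x \<noteq> y"
  shows "prefix (b @ [x]) c \<or> prefix (c @ [y]) b"
  using prefix_same_cases[OF assms(1,2)] assms(3) by (metis last_snoc prefix_snoc)

lemma foldr_hom:
  assumes "group K" and f: "\<And>x. x \<in> S \<Longrightarrow> f x \<in> carrier K"
    and fi: "\<And>x. x \<in> S \<Longrightarrow> f x \<otimes>\<^bsub>K\<^esub> f (\<iota> x) = \<one>\<^bsub>K\<^esub>"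
  shows "(\<lambda>w. foldr (\<lambda>x u. f x \<otimes>\<^bsub>K\<^esub> u) w \<one>\<^bsub>K\<^esub>) \<in> hom G K"
proof -
  interpret K: group K by fact
  let ?l = "\<lambda>w. foldr (\<lambda>x u. f x \<otimes>\<^bsub>K\<^esub> u) w \<one>\<^bsub>K\<^esub>"
  have cl: "?l w \<in> carrier K" if "w \<in> carrier G" for w
    using that by (induction w) (auto simp: carrier_Cons_iff f)
  have step: "?l ([x] \<otimes> w) = f x \<otimes>\<^bsub>K\<^esub> ?l w" if x: "x \<in> S" and w: "w \<in> carrier G" for x w
  proof (cases "x # w \<in> carrier G")
    case True
    then show ?thesis by (simp add: Cons_mult)
  next
    case False
    then obtain v where v: "w = \<iota> x # v" "v \<in> carrier G"
      using x w by (cases w) (auto simp: carrier_Cons_iff)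
    then have "[x] \<otimes> w = v"
      using letter_cancel_left[OF x v(2)] Cons_mult[of "\<iota> x" v] w by simp
    moreover have "f x \<otimes>\<^bsub>K\<^esub> ?l w = ?l v"
      using cl[OF v(2)] f[OF x] f[of "\<iota> x"] fi[OF x] x by (simp add: v K.m_assoc[symmetric])
    ultimately show ?thesis by simp
  qed
  have "?l (u \<otimes> v) = ?l u \<otimes>\<^bsub>K\<^esub> ?l v" if "u \<in> carrier G" "v \<in> carrier G" for u v
    using that(1)
  proof (induction u)
    case Nil
    have "[] \<otimes> v = v" using l_one[OF that(2)] unfolding one_eq .
    then show ?case using cl[OF that(2)] by simp
  next
    case (Cons x u)
    then have c: "x \<in> S" "u \<in> carrier G" by (auto simp: carrier_Cons_iff)
    then have "(x # u) \<otimes> v = [x] \<otimes> (u \<otimes> v)"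
      using Cons_mult[OF Cons.prems] that(2) m_assoc letter_in_carrier by metis
    then show ?case
      using Cons.IH c that(2) step[of x "u \<otimes> v"] cl f by (simp add: K.m_assoc)
  qed
  then show ?thesis using cl by (intro homI)
qed

lemma hom_eqI:
  assumes "group K" "h \<in> hom G K" "k \<in> hom G K" "\<And>x. x \<in> S \<Longrightarrow> h [x] = k [x]"
    and "w \<in> carrier G"
  shows "h w = k w"
proof -
  interpret h: group_hom G K h using assms(1,2) is_group by (simp add: group_hom_def group_hom_axioms_def)
  interpret k: group_hom G K k using assms(1,3) is_group by (simp add: group_hom_def group_hom_axioms_def)
  show ?thesis
    using assms(5)
  proof (induction w)
    case Nil
    then show ?case using h.hom_one k.hom_one one_eq by simp
  next
    case (Cons x w)
    then have c: "x \<in> S" "w \<in> carrier G" "[x] \<in> carrier G"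
      by (auto simp: carrier_Cons_iff letter_in_carrier)
    then show ?case
      using Cons_mult[OF Cons.prems] Cons.IH h.hom_mult[OF c(3,2)] k.hom_mult[OF c(3,2)] assms(4) by simp
  qed
qed

end

section \<open>Elimination of peaks\<close>

text \<open>The elements that are joined to \<open>1\<close> by right multiplications with elements of \<open>T\<close> and \<open>N\<close>, where
the steps in \<open>T\<close> end at elements of rank less than \<open>r\<close>.\<close>

inductive_set below :: "('a, 'm) monoid_scheme \<Rightarrow> 'a set \<Rightarrow> 'a set \<Rightarrow> ('a \<Rightarrow> nat) \<Rightarrow> nat \<Rightarrow> 'a set"
  for G and N and T and L and r where
  below_one: "\<one>\<^bsub>G\<^esub> \<in> below G N T L r"
| below_step: "b \<in> below G N T L r \<Longrightarrow> x \<in> T \<Longrightarrow> L (b \<otimes>\<^bsub>G\<^esub> x) < r \<Longrightarrow> b \<otimes>\<^bsub>G\<^esub> x \<in> below G N T L r"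
| below_coset: "b \<in> below G N T L r \<Longrightarrow> m \<in> N \<Longrightarrow> b \<otimes>\<^bsub>G\<^esub> m \<in> below G N T L r"

lemma below_mono: "b \<in> below G N T L r \<Longrightarrow> r \<le> r' \<Longrightarrow> b \<in> below G N T L r'"
  by (induction rule: below.induct) (auto intro: below.intros)

text \<open>The rank is a height function on the cosets of \<open>N\<close>, which are the vertices of a graph with the
elements of \<open>T\<close> as edges. The assumption \<open>peak\<close> says that two descents \<open>a x\<close> and \<open>a y\<close> from \<open>a\<close> are
joined by a path of elements of rank less than that of \<open>a\<close>; instead of a path it speaks of the sets
\<open>R\<close> that are closed under the steps of such paths, so that no lists of steps occur.\<close>

locale peaks = normal N G for N and G (structure) +
  fixes T :: "'a set" and L :: "'a \<Rightarrow> nat"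
  assumes gens: "T \<subseteq> carrier G"
    and rank_coset: "\<And>a m. a \<in> carrier G \<Longrightarrow> m \<in> N \<Longrightarrow> L (a \<otimes> m) = L a"
    and square: "\<And>x. x \<in> T \<Longrightarrow> x \<otimes> x \<in> N"
    and rank_changes: "\<And>a x. a \<in> carrier G \<Longrightarrow> x \<in> T \<Longrightarrow> L (a \<otimes> x) \<noteq> L a"
    and rank_min: "\<And>a. a \<in> carrier G \<Longrightarrow> L \<one> \<le> L a"
    and peak: "\<And>a x y R. \<lbrakk>a \<in> carrier G; x \<in> T; y \<in> T; L (a \<otimes> x) < L a; L (a \<otimes> y) < L a;
       R \<subseteq> carrier G; \<And>b m. b \<in> R \<Longrightarrow> m \<in> N \<Longrightarrow> b \<otimes> m \<in> R;
       \<And>b z. b \<in> R \<Longrightarrow> z \<in> T \<Longrightarrow> L (b \<otimes> z) < L a \<Longrightarrow> b \<otimes> z \<in> R;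
       a \<otimes> x \<in> R\<rbrakk> \<Longrightarrow> a \<otimes> y \<in> R"
begin

lemma below_carrier: "b \<in> below G N T L r \<Longrightarrow> b \<in> carrier G"
  by (induction rule: below.induct) (use gens subset in auto)

lemma below_rank: "b \<in> below G N T L r \<Longrightarrow> L \<one> < r \<Longrightarrow> L b < r"
  by (induction rule: below.induct) (auto simp: rank_coset below_carrier)

text \<open>Every step in \<open>T\<close> changes the rank. So on a path of rank at most \<open>r\<close> the vertices of rank \<open>r\<close> are
isolated, and each of them can be bypassed by the peak assumption. The second conjunct carries
the induction over such a vertex: it remembers one of its descents instead of the vertex.\<close>

lemma lower_peaks:
  assumes "b \<in> below G N T L (Suc r)" "L \<one> < r"
  shows "(L b < r \<longrightarrow> b \<in> below G N T L r) \<and>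
         (L b = r \<longrightarrow> (\<exists>x\<in>T. L (b \<otimes> x) < r \<and> b \<otimes> x \<in> below G N T L r))"
  using assms(1)
proof (induction rule: below.induct)
  case below_one
  then show ?case using assms(2) by (auto intro: below.intros)
next
  case (below_step b x)
  have c: "b \<in> carrier G" "x \<in> carrier G" using below_step.hyps gens below_carrier by blast+
  have neq: "L (b \<otimes> x) \<noteq> L b" using rank_changes c(1) below_step.hyps(2) by blast
  have "L b \<le> r" using below_rank[OF below_step.hyps(1)] assms(2) by simp
  then consider (lt) "L b < r" | (eq) "L b = r" by linarith
  then show ?case
  proof cases
    case lt
    then have b: "b \<in> below G N T L r" using below_step.IH by blast
    have xx: "b \<otimes> x \<otimes> x = b \<otimes> (x \<otimes> x)" using c by (simp add: m_assoc)
    have "b \<otimes> x \<otimes> x \<in> below G N T L r" "L (b \<otimes> x \<otimes> x) < r"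
      unfolding xx using below.below_coset[OF b square] below_step.hyps(2) rank_coset[OF c(1) square] lt
      by auto
    then show ?thesis using below.below_step[OF b] below_step.hyps(2) by blast
  next
    case eq
    then obtain y where y: "y \<in> T" "L (b \<otimes> y) < r" "b \<otimes> y \<in> below G N T L r"
      using below_step.IH by blast
    have lt: "L (b \<otimes> x) < r" using neq eq below_step.hyps(3) by linarith
    have "b \<otimes> x \<in> below G N T L r"
      by (rule peak[OF c(1) y(1) below_step.hyps(2), where R = "below G N T L r"])
         (use y lt eq below_carrier in \<open>auto intro: below.intros\<close>)
    then show ?thesis using lt by simp
  qed
next
  case (below_coset b m)
  have c: "b \<in> carrier G" "m \<in> carrier G" using below_coset.hyps below_carrier subset by blast+
  have "\<exists>y\<in>T. L (b \<otimes> m \<otimes> y) < r \<and> b \<otimes> m \<otimes> y \<in> below G N T L r" if Lb: "L b = r"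
  proof -
    obtain y where y: "y \<in> T" "L (b \<otimes> y) < r" "b \<otimes> y \<in> below G N T L r"
      using below_coset.IH Lb by blast
    then have yc: "y \<in> carrier G" using gens by blast
    have k: "inv y \<otimes> m \<otimes> y \<in> N" using yc below_coset.hyps(2) inv_op_closed1 by blast
    have "y \<otimes> (inv y \<otimes> (m \<otimes> y)) = m \<otimes> y" using c yc by (simp add: m_assoc[symmetric])
    then have e: "b \<otimes> m \<otimes> y = (b \<otimes> y) \<otimes> (inv y \<otimes> m \<otimes> y)" using c yc by (simp add: m_assoc)
    show ?thesis
      using y below.below_coset[OF y(3) k] rank_coset[OF _ k, of "b \<otimes> y"] c yc
      by (intro bexI[of _ y]) (auto simp: e)
  qed
  then show ?case
    using below_coset rank_coset[OF c(1) below_coset.hyps(2)] by (auto intro: below.intros)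
qed

text \<open>Removing the peaks level by level pushes the whole path down to the minimal rank, where no step
in \<open>T\<close> is possible.\<close>

theorem connected_imp_mem:
  assumes "a \<in> below G N T L r" "L a = L \<one>"
  shows "a \<in> N"
proof -
  have "a \<in> below G N T L (Suc (L \<one> + k)) \<Longrightarrow> a \<in> below G N T L (Suc (L \<one>))" for k
  proof (induction k)
    case (Suc k)
    then show ?case using lower_peaks[of a "Suc (L \<one> + k)"] assms(2) by simp
  qed simp
  moreover have "a \<in> below G N T L (Suc (L \<one> + r))"
    using below_mono[OF assms(1)] by simp
  ultimately have "a \<in> below G N T L (Suc (L \<one>))" by blast
  then show ?thesis
  proof (induction rule: below.induct)
    case (below_step b x)
    have c: "b \<in> carrier G" "b \<otimes> x \<in> carrier G" using below_step.hyps gens below_carrier by auto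
    have "L (b \<otimes> x) = L \<one>" using below_step.hyps(3) rank_min[OF c(2)] by simp
    moreover have "L b = L \<one>" using rank_coset[OF one_closed below_step.IH] c(1) by simp
    ultimately show ?case using rank_changes[OF c(1) below_step.hyps(2)] by simp
  qed simp_all
qed

end

section \<open>Outer automorphism groups\<close>

lemma (in group_hom) normal_vimage:
  assumes "N \<lhd> H"
  shows "{x \<in> carrier G. h x \<in> N} \<lhd> G"
proof -
  interpret N: normal N H by fact
  show ?thesis
  proof (rule G.normal_invI)
    show "subgroup {x \<in> carrier G. h x \<in> N} G"
      by (rule subgroup.intro) auto
  qed (auto intro: N.inv_op_closed2)
qed

lemma AutoGroup_simps:
  "carrier (AutoGroup G) = auto G"
  "\<one>\<^bsub>AutoGroup G\<^esub> = (\<lambda>x\<in>carrier G. x)"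
  "\<lbrakk>\<phi> \<in> auto G; \<psi> \<in> auto G\<rbrakk> \<Longrightarrow> \<phi> \<otimes>\<^bsub>AutoGroup G\<^esub> \<psi> = compose (carrier G) \<phi> \<psi>"
  by (auto simp: AutoGroup_def BijGroup_def auto_def)

lemma autoD:
  assumes "\<phi> \<in> auto G"
  shows "\<phi> \<in> hom G G" "bij_betw \<phi> (carrier G) (carrier G)" "\<phi> \<in> extensional (carrier G)"
    "x \<in> carrier G \<Longrightarrow> \<phi> x \<in> carrier G"
  using assms by (auto simp: auto_def Bij_def bij_betw_def)

lemma autoI:
  assumes "\<phi> \<in> hom G G" "\<psi> \<in> hom G G" "\<phi> \<in> extensional (carrier G)"
    "\<And>x. x \<in> carrier G \<Longrightarrow> \<phi> (\<psi> x) = x" "\<And>x. x \<in> carrier G \<Longrightarrow> \<psi> (\<phi> x) = x"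
  shows "\<phi> \<in> auto G"
proof -
  have "bij_betw \<phi> (carrier G) (carrier G)"
    using assms by (intro bij_betw_byWitness[where f' = \<psi>]) (auto simp: hom_def)
  then show ?thesis using assms by (simp add: auto_def Bij_def)
qed

definition inner :: "('a, 'm) monoid_scheme \<Rightarrow> 'a \<Rightarrow> 'a \<Rightarrow> 'a" where
  "inner G g = (\<lambda>x\<in>carrier G. g \<otimes>\<^bsub>G\<^esub> x \<otimes>\<^bsub>G\<^esub> inv\<^bsub>G\<^esub> g)"

lemma inner_auto_eq: "inner_auto G = inner G ` carrier G"
  by (simp add: inner_auto_def inner_def)

context group
begin

lemma auto_mult_apply:
  "\<lbrakk>\<phi> \<in> auto G; \<psi> \<in> auto G; x \<in> carrier G\<rbrakk> \<Longrightarrow> (\<phi> \<otimes>\<^bsub>AutoGroup G\<^esub> \<psi>) x = \<phi> (\<psi> x)"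
  by (simp add: AutoGroup_simps compose_def)

lemma auto_mult_closed: "\<phi> \<in> auto G \<Longrightarrow> \<psi> \<in> auto G \<Longrightarrow> \<phi> \<otimes>\<^bsub>AutoGroup G\<^esub> \<psi> \<in> auto G"
  using group.is_monoid[OF AutoGroup] monoid.m_closed by (fastforce simp: AutoGroup_simps(1))

lemma auto_inv:
  assumes "\<phi> \<in> auto G"
  shows "inv\<^bsub>AutoGroup G\<^esub> \<phi> \<in> auto G"
    "x \<in> carrier G \<Longrightarrow> \<phi> ((inv\<^bsub>AutoGroup G\<^esub> \<phi>) x) = x"
    "x \<in> carrier G \<Longrightarrow> (inv\<^bsub>AutoGroup G\<^esub> \<phi>) (\<phi> x) = x"
proof -
  interpret A: group "AutoGroup G" by (rule AutoGroup)
  show i: "inv\<^bsub>AutoGroup G\<^esub> \<phi> \<in> auto G" using A.inv_closed assms by (simp add: AutoGroup_simps)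
  have l: "\<phi> \<otimes>\<^bsub>AutoGroup G\<^esub> inv\<^bsub>AutoGroup G\<^esub> \<phi> = \<one>\<^bsub>AutoGroup G\<^esub>"
    "inv\<^bsub>AutoGroup G\<^esub> \<phi> \<otimes>\<^bsub>AutoGroup G\<^esub> \<phi> = \<one>\<^bsub>AutoGroup G\<^esub>"
    using assms A.r_inv A.l_inv by (simp_all add: AutoGroup_simps(1))
  show "\<phi> ((inv\<^bsub>AutoGroup G\<^esub> \<phi>) x) = x" "(inv\<^bsub>AutoGroup G\<^esub> \<phi>) (\<phi> x) = x" if "x \<in> carrier G"
    using l[THEN fun_cong, of x] auto_mult_apply assms i that by (simp_all add: AutoGroup_simps(2))
qed

lemma inner_closed: "g \<in> carrier G \<Longrightarrow> x \<in> carrier G \<Longrightarrow> inner G g x \<in> carrier G"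
  by (simp add: inner_def)

lemma inner_hom: "g \<in> carrier G \<Longrightarrow> inner G g \<in> hom G G"
proof (rule homI)
  fix x y assume c: "g \<in> carrier G" "x \<in> carrier G" "y \<in> carrier G"
  have "inv g \<otimes> (g \<otimes> (y \<otimes> inv g)) = y \<otimes> inv g" using c by (simp add: m_assoc[symmetric])
  then show "inner G g (x \<otimes> y) = inner G g x \<otimes> inner G g y"
    using c by (simp add: inner_def m_assoc)
qed (simp add: inner_closed)

lemma inner_mult_apply:
  "\<lbrakk>g \<in> carrier G; h \<in> carrier G; x \<in> carrier G\<rbrakk> \<Longrightarrow> inner G g (inner G h x) = inner G (g \<otimes> h) x"
  by (simp add: inner_def m_assoc inv_mult_group)

lemma inner_one: "x \<in> carrier G \<Longrightarrow> inner G \<one> x = x"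
  by (simp add: inner_def)

lemma inner_in_auto: "g \<in> carrier G \<Longrightarrow> inner G g \<in> auto G"
  by (rule autoI[of _ _ "inner G (inv g)"])
     (auto simp: inner_hom inner_mult_apply inner_one, simp add: inner_def)

lemma hom_inner:
  "\<lbrakk>\<phi> \<in> hom G H; group H; g \<in> carrier G; x \<in> carrier G\<rbrakk> \<Longrightarrow> \<phi> (inner G g x) = inner H (\<phi> g) (\<phi> x)"
  by (simp add: inner_def hom_mult hom_in_carrier group_hom.hom_inv[OF group_hom.intro] group_hom_axioms_def)

lemma inner_auto_normal: "inner_auto G \<lhd> AutoGroup G"
proof -
  interpret A: group "AutoGroup G" by (rule AutoGroup)
  have m: "inner G g \<otimes>\<^bsub>AutoGroup G\<^esub> inner G h = inner G (g \<otimes> h)" if "g \<in> carrier G" "h \<in> carrier G" for g h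
    using that autoD(3)[OF auto_mult_closed[OF inner_in_auto inner_in_auto]] autoD(3)[OF inner_in_auto]
    by (intro extensionalityI[of _ "carrier G"]) (auto simp: auto_mult_apply inner_in_auto inner_mult_apply)
  have o: "\<one>\<^bsub>AutoGroup G\<^esub> = inner G \<one>"
    by (auto simp: AutoGroup_simps inner_def)
  have i: "inv\<^bsub>AutoGroup G\<^esub> inner G g = inner G (inv g)" if "g \<in> carrier G" for g
    using that by (intro A.inv_equality) (auto simp: m o AutoGroup_simps(1) inner_in_auto)
  have c: "\<phi> \<otimes>\<^bsub>AutoGroup G\<^esub> inner G g \<otimes>\<^bsub>AutoGroup G\<^esub> inv\<^bsub>AutoGroup G\<^esub> \<phi> = inner G (\<phi> g)"
    if "\<phi> \<in> auto G" "g \<in> carrier G" for \<phi> g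
  proof (rule extensionalityI[of _ "carrier G"])
    have a: "\<phi> \<otimes>\<^bsub>AutoGroup G\<^esub> inner G g \<in> auto G"
      using A.m_closed that inner_in_auto by (simp add: AutoGroup_simps(1))
    show "\<phi> \<otimes>\<^bsub>AutoGroup G\<^esub> inner G g \<otimes>\<^bsub>AutoGroup G\<^esub> inv\<^bsub>AutoGroup G\<^esub> \<phi> \<in> extensional (carrier G)"
      using a auto_inv(1)[OF that(1)] by (simp add: AutoGroup_simps(3))
    show "inner G (\<phi> g) \<in> extensional (carrier G)" by (simp add: inner_def)
    fix x assume x: "x \<in> carrier G"
    show "(\<phi> \<otimes>\<^bsub>AutoGroup G\<^esub> inner G g \<otimes>\<^bsub>AutoGroup G\<^esub> inv\<^bsub>AutoGroup G\<^esub> \<phi>) x = inner G (\<phi> g) x"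
      using a that x auto_inv[OF that(1)] autoD(4)[OF auto_inv(1)[OF that(1)]] inner_in_auto hom_inner[OF autoD(1)[OF that(1)]] is_group
      by (simp add: auto_mult_apply)
  qed
  show ?thesis
  proof (rule A.normal_invI)
    show "subgroup (inner_auto G) (AutoGroup G)"
      unfolding inner_auto_eq
      by (rule subgroup.intro) (auto simp: m o i AutoGroup_simps(1) inner_in_auto)
  qed (auto simp: inner_auto_eq c AutoGroup_simps(1) autoD(4))
qed

lemma out_class_group_hom: "group_hom (AutoGroup G) (OutGroup G) (out_class G)"
proof -
  interpret N: normal "inner_auto G" "AutoGroup G" by (rule inner_auto_normal)
  show ?thesis
    unfolding OutGroup_def out_class_def
    using N.r_coset_hom_Mod N.factorgroup_is_group AutoGroup
    by (simp add: group_hom_def group_hom_axioms_def)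
qed

lemma out_class_eq:
  assumes "\<phi> \<in> auto G"
  shows "out_class G \<phi> = (\<lambda>g. inner G g \<otimes>\<^bsub>AutoGroup G\<^esub> \<phi>) ` carrier G"
  by (auto simp: out_class_def r_coset_def inner_auto_eq)

lemma out_class_inner_mult:
  assumes "g \<in> carrier G" "\<phi> \<in> auto G"
  shows "out_class G (inner G g \<otimes>\<^bsub>AutoGroup G\<^esub> \<phi>) = out_class G \<phi>"
proof -
  interpret N: normal "inner_auto G" "AutoGroup G" by (rule inner_auto_normal)
  have "out_class G (inner G g \<otimes>\<^bsub>AutoGroup G\<^esub> \<phi>) = (inner_auto G #>\<^bsub>AutoGroup G\<^esub> inner G g) #>\<^bsub>AutoGroup G\<^esub> \<phi>"
    unfolding out_class_def
    using assms N.coset_mult_assoc[OF N.subset] inner_in_auto by (simp add: AutoGroup_simps(1))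
  also have "inner_auto G #>\<^bsub>AutoGroup G\<^esub> inner G g = inner_auto G"
    using assms by (intro N.rcos_const) (auto simp: inner_auto_eq)
  finally show ?thesis by (simp add: out_class_def)
qed

end

section \<open>The groups \<open>F\<^sub>n\<close> and \<open>H\<^sub>n\<close> and the reduction map\<close>

definition inv_letter :: "'a \<times> bool \<Rightarrow> 'a \<times> bool" where
  "inv_letter x = (fst x, \<not> snd x)"

lemma word_group_free_group: "word_group (free_group I) (I \<times> UNIV) inv_letter"
proof -
  have m: "x \<otimes>\<^bsub>free_group I\<^esub> y = foldr free_cons x y" for x y by (simp add: free_group_def)
  have "freely_reduced w \<longleftrightarrow> successively (\<lambda>x y. y \<noteq> inv_letter x) w" for w :: "('a \<times> bool) list"
  proof -
    have "(\<lambda>(i, b) (j, c). \<not> (i = j \<and> b \<noteq> c)) = (\<lambda>x y. y \<noteq> inv_letter (x :: 'a \<times> bool))"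
      by (auto simp: fun_eq_iff inv_letter_def)
    then show ?thesis by (simp add: freely_reduced_def)
  qed
  then show ?thesis
    by (intro word_group.intro[OF group_free_group] word_group_axioms.intro)
       (auto simp: free_group_def inv_letter_def free_cons_reduced)
qed

lemma word_group_Hn: "word_group (Hn n) ({1..n} \<times> {1}) id"
proof -
  let ?Z = "\<lambda>_. integer_mod_group 2"
  have Z: "g \<in> carrier (integer_mod_group 2) \<and> g \<noteq> \<one>\<^bsub>integer_mod_group 2\<^esub> \<longleftrightarrow> g = 1" for g
    by (auto simp: integer_mod_group_def)
  have w: "w \<in> carrier (free_product I ?Z) \<longleftrightarrow> set w \<subseteq> I \<times> {1} \<and> successively (\<lambda>x y. y \<noteq> id x) w"
    for w :: "(nat \<times> int) list" and I
  proof (induction w)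
    case Nil
    then show ?case by (simp add: Nil_in_free_product)
  next
    case (Cons x w)
    obtain i g where x: "x = (i, g)" by (cases x)
    have "(x # w \<in> carrier (free_product I ?Z)) \<longleftrightarrow>
      i \<in> I \<and> g = 1 \<and> (w = [] \<or> fst (hd w) \<noteq> i) \<and> w \<in> carrier (free_product I ?Z)"
      unfolding x carrier_free_product_Cons using Z[of g] by blast
    also have "\<dots> \<longleftrightarrow> set (x # w) \<subseteq> I \<times> {1} \<and> successively (\<lambda>x y. y \<noteq> id x) (x # w)"
      unfolding Cons.IH by (cases w) (auto simp: x)
    finally show ?case .
  qed
  have m: "[x] \<otimes>\<^bsub>free_product I ?Z\<^esub> y = syllable_cons ?Z x y" for x y I
    by (simp add: free_product_def)
  show ?thesis
  proof (intro word_group.intro[OF group_Hn] word_group_axioms.intro)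
    show "carrier (Hn n) = {w. set w \<subseteq> {1..n} \<times> {1} \<and> successively (\<lambda>x y. y \<noteq> id x) w}"
      using w by (auto simp: Hn_def simp del: id_apply)
    show "\<one>\<^bsub>Hn n\<^esub> = []" by (simp add: Hn_def free_product_def)
    show "[x] \<otimes>\<^bsub>Hn n\<^esub> w = x # w" if "x # w \<in> carrier (Hn n)" for x w
      using that unfolding Hn_def m by (cases x) (simp add: syllable_cons_reduced)
    show "[x] \<otimes>\<^bsub>Hn n\<^esub> [id x] = \<one>\<^bsub>Hn n\<^esub>" if "x \<in> {1..n} \<times> {1}" for x
      using that zgen_order_two(1)[of n "fst x"] by (auto simp: zgen_def)
  qed auto
qed

interpretation F: word_group "Fn n" "{1..n} \<times> UNIV" inv_letter for n
  by (rule word_group_free_group)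

interpretation H: word_group "Hn n" "{1..n} \<times> {1}" id for n
  by (rule word_group_Hn)

lemma ygen_carrier: "i \<in> {1..n} \<Longrightarrow> ygen i \<in> carrier (Fn n)"
  by (rule free_gen_carrier)

lemma letter_eq:
  assumes "i \<in> {1..n}"
  shows "[(i, b)] = (if b then ygen i else inv\<^bsub>Fn n\<^esub> (ygen i))"
  using F.inv_letter[of "(i, True)" n] assms by (auto simp: free_gen_def inv_letter_def)

lemma hom_letter:
  assumes "group K" "h \<in> hom (Fn n) K" "i \<in> {1..n}"
  shows "h [(i, b)] = (if b then h (ygen i) else inv\<^bsub>K\<^esub> (h (ygen i)))"
proof -
  interpret h: group_hom "Fn n" K h
    using assms F.is_group by (simp add: group_hom_def group_hom_axioms_def)
  show ?thesis using letter_eq[OF assms(3)] ygen_carrier[OF assms(3)] by simp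
qed

lemma hom_eq_on_gens:
  assumes "group K" "h \<in> hom (Fn n) K" "k \<in> hom (Fn n) K" "\<And>i. i \<in> {1..n} \<Longrightarrow> h (ygen i) = k (ygen i)"
    and "w \<in> carrier (Fn n)"
  shows "h w = k w"
  by (rule F.hom_eqI[OF assms(1-3) _ assms(5)])
     (use hom_letter[OF assms(1,2)] hom_letter[OF assms(1,3)] assms(4) in auto)

lemma auto_eq_on_gens:
  assumes "\<phi> \<in> auto (Fn n)" "\<psi> \<in> auto (Fn n)" "\<And>i. i \<in> {1..n} \<Longrightarrow> \<phi> (ygen i) = \<psi> (ygen i)"
  shows "\<phi> = \<psi>"
  by (rule extensionalityI[of _ "carrier (Fn n)"])
     (use autoD(1,3)[OF assms(1)] autoD(1,3)[OF assms(2)] assms(3) hom_eq_on_gens[OF F.is_group] in auto)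

definition free_endo :: "nat \<Rightarrow> (nat \<Rightarrow> (nat \<times> bool) list) \<Rightarrow> (nat \<times> bool) list \<Rightarrow> (nat \<times> bool) list" where
  "free_endo n f = (\<lambda>w\<in>carrier (Fn n). free_lift (Fn n) f w)"

lemma free_endo:
  assumes "\<And>i. i \<in> {1..n} \<Longrightarrow> f i \<in> carrier (Fn n)"
  shows "free_endo n f \<in> hom (Fn n) (Fn n)" "free_endo n f \<in> extensional (carrier (Fn n))"
    "\<And>i. i \<in> {1..n} \<Longrightarrow> free_endo n f (ygen i) = f i"
proof -
  have "free_lift (Fn n) f \<in> hom (Fn n) (Fn n)"
    using assms by (intro free_lift_hom F.is_group)
  then show "free_endo n f \<in> hom (Fn n) (Fn n)"
    by (auto simp: free_endo_def hom_def)
  show "free_endo n f (ygen i) = f i" if "i \<in> {1..n}" for i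
    using that assms ygen_carrier[OF that] by (simp add: free_endo_def free_lift_gen[OF F.is_group])
qed (simp add: free_endo_def)

text \<open>The universal property of the free group turns two families of words that are inverse to each
other on the generators into an automorphism.\<close>

lemma free_endo_auto:
  assumes "\<And>i. i \<in> {1..n} \<Longrightarrow> f i \<in> carrier (Fn n)" "\<And>i. i \<in> {1..n} \<Longrightarrow> g i \<in> carrier (Fn n)"
    and "\<And>i. i \<in> {1..n} \<Longrightarrow> free_endo n f (g i) = ygen i" "\<And>i. i \<in> {1..n} \<Longrightarrow> free_endo n g (f i) = ygen i"
  shows "free_endo n f \<in> auto (Fn n)"
proof -
  note f = free_endo[OF assms(1)] and g = free_endo[OF assms(2)]
  have i: "(\<lambda>x. x) \<in> hom (Fn n) (Fn n)" by (simp add: hom_def)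
  show ?thesis
  proof (rule autoI[OF f(1) g(1) f(2)])
    show "free_endo n f (free_endo n g x) = x" if "x \<in> carrier (Fn n)" for x
      using hom_eq_on_gens[OF F.is_group hom_compose[OF g(1) f(1)] i _ that] g(3) assms(3) by simp
    show "free_endo n g (free_endo n f x) = x" if "x \<in> carrier (Fn n)" for x
      using hom_eq_on_gens[OF F.is_group hom_compose[OF f(1) g(1)] i _ that] f(3) assms(4) by simp
  qed
qed

interpretation pi: group_hom "Fn n" "Hn n" "pi_map n" for n
  by (simp add: group_hom_def group_hom_axioms_def F.is_group group_Hn pi_map_hom)

lemma pi_letter: "x \<in> {1..n} \<times> UNIV \<Longrightarrow> pi_map n [x] = [(fst x, 1)]"
  using hom_letter[OF group_Hn pi_map_hom, of "fst x" n "snd x"] pi_map_gen[of "fst x" n]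
    H.inv_letter[of "(fst x, 1)" n]
  by (auto simp: zgen_def mem_Times_iff)

lemma pi_conj_letter:
  "g \<in> carrier (Fn n) \<Longrightarrow> x \<in> {1..n} \<times> UNIV \<Longrightarrow>
     pi_map n (F.conj_letter n g x) = H.conj_letter n (pi_map n g) (fst x, 1)"
  by (simp add: F.conj_letter_def H.conj_letter_def pi_letter F.letter_in_carrier)

lemma pi_surj: "h \<in> carrier (Hn n) \<Longrightarrow> \<exists>g\<in>carrier (Fn n). pi_map n g = h"
proof (induction h)
  case Nil
  then show ?case using pi.hom_one[of n] F.one_closed[of n] H.one_eq[of n] by metis
next
  case (Cons x h)
  then have c: "x \<in> {1..n} \<times> {1}" "h \<in> carrier (Hn n)" by (auto simp: H.carrier_Cons_iff)
  then obtain g where g: "g \<in> carrier (Fn n)" "pi_map n g = h" using Cons.IH by blast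
  have y: "(fst x, True) \<in> {1..n} \<times> UNIV" "[(fst x, 1)] = [x]" using c by auto
  have "pi_map n ([(fst x, True)] \<otimes>\<^bsub>Fn n\<^esub> g) = x # h"
    using g y pi_letter[OF y(1)] H.Cons_mult[OF Cons.prems]
    by (subst pi.hom_mult) (auto simp: F.letter_in_carrier)
  moreover have "[(fst x, True)] \<otimes>\<^bsub>Fn n\<^esub> g \<in> carrier (Fn n)"
    using g(1) y(1) by (simp add: F.letter_in_carrier)
  ultimately show ?case by blast
qed

text \<open>The number of occurrences of the generator \<open>k\<close> mod 2. It is a conjugation invariant that tells
the generators apart.\<close>

definition parity :: "nat \<Rightarrow> (nat \<times> int) list \<Rightarrow> int" where
  "parity k w = foldr (\<lambda>x u. (if fst x = k then 1 else 0) \<otimes>\<^bsub>integer_mod_group 2\<^esub> u) w \<one>\<^bsub>integer_mod_group 2\<^esub>"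

lemma parity_hom: "parity k \<in> hom (Hn n) (integer_mod_group 2)"
  unfolding parity_def[abs_def]
proof (rule H.foldr_hom)
  show "group (integer_mod_group 2)" by simp
qed (auto simp: integer_mod_group_def)

lemma parity_conj_letter:
  assumes "h \<in> carrier (Hn n)" "i \<in> {1..n}"
  shows "parity k (H.conj_letter n h (i, 1)) = (if i = k then 1 else 0)"
proof -
  interpret p: group_hom "Hn n" "integer_mod_group 2" "parity k"
    using parity_hom by (simp add: group_hom_def group_hom_axioms_def group_Hn)
  interpret Z: comm_group "integer_mod_group 2" by simp
  have l: "[(i, 1)] \<in> carrier (Hn n)" using assms by (simp add: H.letter_in_carrier)
  have v: "parity k [(i, 1)] = (if i = k then 1 else 0)"
    by (simp add: parity_def integer_mod_group_def)
  have "parity k (H.conj_letter n h (i, 1)) = parity k [(i, 1)] mod 2"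
    using assms l p.hom_closed[OF l] p.hom_closed[OF assms(1)]
    by (simp add: H.conj_letter_def mod_simps)
  then show ?thesis by (simp add: v)
qed

section \<open>Symmetric automorphisms and the automorphisms they induce on \<open>H\<^sub>n\<close>\<close>

abbreviation SymAut :: "nat \<Rightarrow> ((nat \<times> bool) list \<Rightarrow> (nat \<times> bool) list) set" where
  "SymAut n \<equiv> sym_auto (Fn n) (ygen ` {1..n})"

lemma sym_auto_iff:
  "\<phi> \<in> SymAut n \<longleftrightarrow> \<phi> \<in> auto (Fn n) \<and>
     (\<forall>i\<in>{1..n}. \<exists>g\<in>carrier (Fn n). \<exists>x\<in>{1..n} \<times> UNIV. \<phi> (ygen i) = F.conj_letter n g x)"
proof -
  have "(\<exists>t\<in>ygen ` {1..n}. v = g \<otimes>\<^bsub>Fn n\<^esub> t \<otimes>\<^bsub>Fn n\<^esub> inv\<^bsub>Fn n\<^esub> g \<or>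
           v = g \<otimes>\<^bsub>Fn n\<^esub> inv\<^bsub>Fn n\<^esub> t \<otimes>\<^bsub>Fn n\<^esub> inv\<^bsub>Fn n\<^esub> g) \<longleftrightarrow>
        (\<exists>x\<in>{1..n} \<times> UNIV. v = F.conj_letter n g x)" for v g
  proof -
    have "(\<exists>x\<in>{1..n} \<times> UNIV. v = F.conj_letter n g x) \<longleftrightarrow>
      (\<exists>i\<in>{1..n}. v = F.conj_letter n g (i, True) \<or> v = F.conj_letter n g (i, False))"
      by (auto simp: UNIV_bool)
    moreover have "v = g \<otimes>\<^bsub>Fn n\<^esub> ygen i \<otimes>\<^bsub>Fn n\<^esub> inv\<^bsub>Fn n\<^esub> g \<longleftrightarrow> v = F.conj_letter n g (i, True)"
      "v = g \<otimes>\<^bsub>Fn n\<^esub> inv\<^bsub>Fn n\<^esub> ygen i \<otimes>\<^bsub>Fn n\<^esub> inv\<^bsub>Fn n\<^esub> g \<longleftrightarrow> v = F.conj_letter n g (i, False)"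
      if "i \<in> {1..n}" for i
      using letter_eq[OF that] by (simp_all add: F.conj_letter_def)
    ultimately show ?thesis by (simp del: atLeastAtMost_iff cong: bex_cong)
  qed
  then show ?thesis by (auto simp: sym_auto_def simp del: atLeastAtMost_iff)
qed

lemma sym_auto_subset: "SymAut n \<subseteq> auto (Fn n)"
  by (auto simp: sym_auto_def)

lemma hom_letter_closed:
  assumes "\<phi> \<in> hom (Fn n) (Fn n)" "i \<in> {1..n}" "g \<in> carrier (Fn n)" "x \<in> {1..n} \<times> UNIV"
    "\<phi> (ygen i) = F.conj_letter n g x"
  shows "\<phi> [(i, b)] = F.conj_letter n g (if b then x else inv_letter x)"
  using hom_letter[OF F.is_group assms(1,2), of b] assms F.inv_conj_letter[OF assms(3,4)] by simp

lemma sym_auto_letter: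
  assumes "\<phi> \<in> SymAut n" "x \<in> {1..n} \<times> UNIV"
  shows "\<exists>g\<in>carrier (Fn n). \<exists>y\<in>{1..n} \<times> UNIV. \<phi> [x] = F.conj_letter n g y"
proof -
  obtain i b where x: "x = (i, b)" "i \<in> {1..n}" using assms(2) by auto
  obtain g y where g: "g \<in> carrier (Fn n)" "y \<in> {1..n} \<times> UNIV" "\<phi> (ygen i) = F.conj_letter n g y"
    using assms(1) x(2) sym_auto_iff by blast
  have "\<phi> \<in> hom (Fn n) (Fn n)" using assms(1) sym_auto_subset autoD(1) by blast
  then have "\<phi> [x] = F.conj_letter n g (if b then y else inv_letter y)"
    unfolding x(1) using hom_letter_closed x(2) g by blast
  moreover have "(if b then y else inv_letter y) \<in> {1..n} \<times> UNIV"
    using g(2) F.iota_in_iff[of y n] by auto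
  ultimately show ?thesis using g(1) by (intro bexI)
qed

lemma hom_conj_letter:
  assumes "\<phi> \<in> hom (Fn n) (Fn n)" "g \<in> carrier (Fn n)" "x \<in> {1..n} \<times> UNIV"
  shows "\<phi> (F.conj_letter n g x) = \<phi> g \<otimes>\<^bsub>Fn n\<^esub> \<phi> [x] \<otimes>\<^bsub>Fn n\<^esub> inv\<^bsub>Fn n\<^esub> (\<phi> g)"
proof -
  interpret p: group_hom "Fn n" "Fn n" \<phi>
    using assms(1) F.is_group by (simp add: group_hom_def group_hom_axioms_def)
  show ?thesis using assms by (simp add: F.conj_letter_def F.letter_in_carrier)
qed

lemma sym_auto_mult:
  assumes "\<phi> \<in> SymAut n" "\<psi> \<in> SymAut n"
  shows "\<phi> \<otimes>\<^bsub>AutoGroup (Fn n)\<^esub> \<psi> \<in> SymAut n"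
proof -
  have a: "\<phi> \<in> auto (Fn n)" "\<psi> \<in> auto (Fn n)" using assms sym_auto_subset by auto
  have "\<exists>g\<in>carrier (Fn n). \<exists>x\<in>{1..n} \<times> UNIV. (\<phi> \<otimes>\<^bsub>AutoGroup (Fn n)\<^esub> \<psi>) (ygen i) = F.conj_letter n g x"
    if i: "i \<in> {1..n}" for i
  proof -
    obtain g x where g: "g \<in> carrier (Fn n)" "x \<in> {1..n} \<times> UNIV" "\<psi> (ygen i) = F.conj_letter n g x"
      using assms(2) i sym_auto_iff by blast
    obtain h y where h: "h \<in> carrier (Fn n)" "y \<in> {1..n} \<times> UNIV" "\<phi> [x] = F.conj_letter n h y"
      using sym_auto_letter[OF assms(1) g(2)] by blast
    have pg: "\<phi> g \<in> carrier (Fn n)" using autoD(4)[OF a(1)] g(1) by blast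
    have "(\<phi> \<otimes>\<^bsub>AutoGroup (Fn n)\<^esub> \<psi>) (ygen i) = F.conj_letter n (\<phi> g \<otimes>\<^bsub>Fn n\<^esub> h) y"
      using F.auto_mult_apply[OF a ygen_carrier[OF i]] g h pg hom_conj_letter[OF autoD(1)[OF a(1)] g(1,2)]
      by (simp add: F.conj_conj_letter)
    then show ?thesis using pg h F.m_closed by blast
  qed
  then show ?thesis using F.auto_mult_closed[OF a] sym_auto_iff by blast
qed

text \<open>A symmetric automorphism permutes the conjugacy classes of the generators up to inversion: if the
class of \<open>y\<^sub>k\<close> were missed, the parity of \<open>k\<close> would vanish on the image, hence everywhere. This is
what makes the inverse of a symmetric automorphism symmetric.\<close>

lemma sym_auto_onto:
  assumes "\<phi> \<in> SymAut n" "k \<in> {1..n}"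
  shows "\<exists>i\<in>{1..n}. \<exists>g\<in>carrier (Fn n). \<exists>b. \<phi> (ygen i) = F.conj_letter n g (k, b)"
proof (rule ccontr)
  assume "\<not> ?thesis"
  then have no: "\<phi> (ygen i) \<noteq> F.conj_letter n g (k, b)" if "i \<in> {1..n}" "g \<in> carrier (Fn n)" for i g b
    using that by blast
  have a: "\<phi> \<in> auto (Fn n)" using assms sym_auto_subset by auto
  let ?d = "\<lambda>w. parity k (pi_map n w)"
  let ?Z = "integer_mod_group 2"
  have Z: "group ?Z" by simp
  have d: "?d \<in> hom (Fn n) ?Z"
    using hom_compose[OF pi_map_hom parity_hom] by (simp add: comp_def)
  have dp: "(\<lambda>w. ?d (\<phi> w)) \<in> hom (Fn n) ?Z"
    using hom_compose[OF autoD(1)[OF a] d] by (simp add: comp_def)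
  have "?d (\<phi> (ygen i)) = 0" if i: "i \<in> {1..n}" for i
  proof -
    obtain g x where g: "g \<in> carrier (Fn n)" "x \<in> {1..n} \<times> UNIV" "\<phi> (ygen i) = F.conj_letter n g x"
      using assms(1) i sym_auto_iff by blast
    then have "fst x \<noteq> k" using no[OF i g(1)] by (metis prod.collapse)
    then show ?thesis using g parity_conj_letter[of "pi_map n g" n "fst x" k]
      by (auto simp: pi_conj_letter)
  qed
  moreover have "(\<lambda>w. 0) \<in> hom (Fn n) ?Z" by (auto simp: hom_def integer_mod_group_def)
  ultimately have 0: "?d (\<phi> w) = 0" if "w \<in> carrier (Fn n)" for w
    using hom_eq_on_gens[OF Z dp, of "\<lambda>w. 0"] that by blast
  obtain w where w: "w \<in> carrier (Fn n)" "\<phi> w = ygen k"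
    using bij_betw_imp_surj_on[OF autoD(2)[OF a]] ygen_carrier[OF assms(2)] by (metis imageE)
  have "parity k (zgen k) = 1" by (simp add: parity_def zgen_def integer_mod_group_def)
  then show False using 0[OF w(1)] w(2) pi_map_gen[OF assms(2)] by simp
qed

lemma sym_auto_inv:
  assumes "\<phi> \<in> SymAut n"
  shows "inv\<^bsub>AutoGroup (Fn n)\<^esub> \<phi> \<in> SymAut n"
proof -
  let ?p = "inv\<^bsub>AutoGroup (Fn n)\<^esub> \<phi>"
  have a: "\<phi> \<in> auto (Fn n)" using assms sym_auto_subset by auto
  note inv = F.auto_inv[OF a]
  have "\<exists>g\<in>carrier (Fn n). \<exists>x\<in>{1..n} \<times> UNIV. ?p (ygen k) = F.conj_letter n g x"
    if k: "k \<in> {1..n}" for k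
  proof -
    obtain i g b where g: "i \<in> {1..n}" "g \<in> carrier (Fn n)" "\<phi> (ygen i) = F.conj_letter n g (k, b)"
      using sym_auto_onto[OF assms k] by blast
    interpret p: group_hom "Fn n" "Fn n" \<phi>
      using autoD(1)[OF a] F.is_group by (simp add: group_hom_def group_hom_axioms_def)
    let ?h = "inv\<^bsub>Fn n\<^esub> (?p g)"
    have pg: "?p g \<in> carrier (Fn n)" using autoD(4)[OF inv(1)] g(2) by blast
    have kb: "(i, b) \<in> {1..n} \<times> UNIV" "(k, b) \<in> {1..n} \<times> UNIV" "(k, True) \<in> {1..n} \<times> UNIV"
      using k g(1) by auto
    have e: "\<phi> [(i, b)] = F.conj_letter n g (k, True)"
      using hom_letter_closed[OF autoD(1)[OF a] g(1,2) kb(2) g(3), of b] by (auto simp: inv_letter_def)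
    have "\<phi> (F.conj_letter n ?h (i, b)) = F.conj_letter n [] (k, True)"
      using hom_conj_letter[OF autoD(1)[OF a], of ?h "(i, b)"] pg kb e inv(2)[OF g(2)] g(2)
        F.conj_conj_letter[of "inv\<^bsub>Fn n\<^esub> g" n g "(k, True)"] F.one_eq[of n]
      by simp
    also have "\<dots> = ygen k"
      using F.conj_letter_stem[of n "[]" "(k, True)"] kb by (simp add: F.stem_iff free_gen_def)
    finally have "\<phi> (F.conj_letter n ?h (i, b)) = ygen k" .
    then have "?p (ygen k) = F.conj_letter n ?h (i, b)"
      using inv(3)[of "F.conj_letter n ?h (i, b)"] pg kb F.conj_letter_closed by auto
    then show ?thesis using pg kb by blast
  qed
  then show ?thesis using inv(1) sym_auto_iff by blast
qed

lemma inner_sym_auto: "g \<in> carrier (Fn n) \<Longrightarrow> inner (Fn n) g \<in> SymAut n"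
  unfolding sym_auto_iff
proof (intro conjI ballI)
  fix i assume g: "g \<in> carrier (Fn n)" and i: "i \<in> {1..n}"
  show "\<exists>h\<in>carrier (Fn n). \<exists>x\<in>{1..n} \<times> UNIV. inner (Fn n) g (ygen i) = F.conj_letter n h x"
    using g i ygen_carrier[OF i] letter_eq[OF i, of True]
    by (intro bexI[of _ g] bexI[of _ "(i, True)"]) (auto simp: inner_def F.conj_letter_def)
qed (rule F.inner_in_auto)

lemma subgroup_SymAut: "subgroup (SymAut n) (AutoGroup (Fn n))"
proof (rule group.subgroupI[OF F.AutoGroup])
  show "SymAut n \<noteq> {}" using inner_sym_auto F.one_closed by blast
qed (use sym_auto_subset sym_auto_inv sym_auto_mult in \<open>auto simp: AutoGroup_simps(1)\<close>)

abbreviation SymAutGroup :: "nat \<Rightarrow> ((nat \<times> bool) list \<Rightarrow> (nat \<times> bool) list) monoid" where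
  "SymAutGroup n \<equiv> AutoGroup (Fn n) \<lparr>carrier := SymAut n\<rparr>"

lemma group_SymAut: "group (SymAutGroup n)"
  using subgroup.subgroup_is_group[OF subgroup_SymAut F.AutoGroup] .

lemma group_SymOut_F: "group (SymOut_F n)"
proof -
  interpret o: group_hom "AutoGroup (Fn n)" "OutGroup (Fn n)" "out_class (Fn n)"
    by (rule F.out_class_group_hom)
  have "subgroup (out_class (Fn n) ` SymAut n) (OutGroup (Fn n))"
    using o.subgroup_img_is_subgroup[OF subgroup_SymAut] .
  then show ?thesis unfolding SymOut_def by (rule subgroup.subgroup_is_group) (rule o.H.is_group)
qed

lemma out_class_hom_SymOut: "group_hom (SymAutGroup n) (SymOut_F n) (out_class (Fn n))"
proof -
  interpret o: group_hom "AutoGroup (Fn n)" "OutGroup (Fn n)" "out_class (Fn n)"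
    by (rule F.out_class_group_hom)
  have "out_class (Fn n) \<in> hom (SymAutGroup n) (SymOut_F n)"
  proof (rule homI)
    fix \<phi> \<psi> assume "\<phi> \<in> carrier (SymAutGroup n)" "\<psi> \<in> carrier (SymAutGroup n)"
    then have "\<phi> \<in> carrier (AutoGroup (Fn n))" "\<psi> \<in> carrier (AutoGroup (Fn n))"
      using sym_auto_subset[of n] by (auto simp: AutoGroup_simps(1))
    then show "out_class (Fn n) (\<phi> \<otimes>\<^bsub>SymAutGroup n\<^esub> \<psi>)
      = out_class (Fn n) \<phi> \<otimes>\<^bsub>SymOut_F n\<^esub> out_class (Fn n) \<psi>"
      by (simp add: SymOut_def)
  qed (simp add: SymOut_def)
  then show ?thesis
    using group_SymAut group_SymOut_F by (simp add: group_hom_def group_hom_axioms_def)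
qed

abbreviation reduction :: "nat \<Rightarrow> ((nat \<times> bool) list \<Rightarrow> (nat \<times> bool) list) \<Rightarrow> (nat \<times> int) list \<Rightarrow> (nat \<times> int) list" where
  "reduction n \<phi> \<equiv> induced_map (Fn n) (Hn n) (pi_map n) \<phi>"

lemma H_conj_letter_square:
  "h \<in> carrier (Hn n) \<Longrightarrow> i \<in> {1..n} \<Longrightarrow>
     H.conj_letter n h (i, 1) \<otimes>\<^bsub>Hn n\<^esub> H.conj_letter n h (i, 1) = \<one>\<^bsub>Hn n\<^esub>"
  using H.inv_conj_letter[of h n "(i, 1)"] H.r_inv[OF H.conj_letter_closed[of h n "(i, 1)"]] by simp

text \<open>The image of a generator under a symmetric automorphism becomes an involution in \<open>H\<^sub>n\<close>, so the
assignment \<open>z\<^sub>i \<mapsto> \<pi> (\<phi> y\<^sub>i)\<close> extends to \<open>H\<^sub>n\<close>. In particular \<open>\<phi>\<close> preserves the kernel of \<open>\<pi>\<close>.\<close>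

lemma reduction_exists:
  assumes "\<phi> \<in> SymAut n"
  obtains h where "h \<in> hom (Hn n) (Hn n)" "\<And>x. x \<in> carrier (Fn n) \<Longrightarrow> h (pi_map n x) = pi_map n (\<phi> x)"
proof -
  have a: "\<phi> \<in> auto (Fn n)" using assms sym_auto_subset by auto
  let ?f = "\<lambda>x :: nat \<times> int. pi_map n (\<phi> (ygen (fst x)))"
  let ?h = "\<lambda>w. foldr (\<lambda>x u. ?f x \<otimes>\<^bsub>Hn n\<^esub> u) w \<one>\<^bsub>Hn n\<^esub>"
  have f: "?f x \<in> carrier (Hn n)" "?f x \<otimes>\<^bsub>Hn n\<^esub> ?f (id x) = \<one>\<^bsub>Hn n\<^esub>" if x: "x \<in> {1..n} \<times> {1}" for x
  proof -
    have i: "fst x \<in> {1..n}" using x by auto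
    show "?f x \<in> carrier (Hn n)" using autoD(4)[OF a ygen_carrier[OF i]] by simp
    obtain g y where g: "g \<in> carrier (Fn n)" "y \<in> {1..n} \<times> UNIV" "\<phi> (ygen (fst x)) = F.conj_letter n g y"
      using assms i sym_auto_iff by blast
    then have "fst y \<in> {1..n}" "pi_map n g \<in> carrier (Hn n)" by auto
    then show "?f x \<otimes>\<^bsub>Hn n\<^esub> ?f (id x) = \<one>\<^bsub>Hn n\<^esub>"
      using H_conj_letter_square[of "pi_map n g" n "fst y"] by (simp add: g(3) pi_conj_letter[OF g(1,2)])
  qed
  have h: "?h \<in> hom (Hn n) (Hn n)"
    by (rule H.foldr_hom[where f = ?f, OF group_Hn f])
  have e: "(?h \<circ> pi_map n) (ygen i) = (pi_map n \<circ> \<phi>) (ygen i)" if i: "i \<in> {1..n}" for i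
    using f(1)[of "(i, 1)"] i by (simp add: pi_map_gen zgen_def del: atLeastAtMost_iff)
  have "(?h \<circ> pi_map n) x = (pi_map n \<circ> \<phi>) x" if "x \<in> carrier (Fn n)" for x
    using hom_eq_on_gens[OF group_Hn hom_compose[OF pi_map_hom h] hom_compose[OF autoD(1)[OF a] pi_map_hom] e that] .
  then show ?thesis using that[OF h] by simp
qed

lemma reduction_pi:
  assumes "\<phi> \<in> SymAut n" "x \<in> carrier (Fn n)"
  shows "reduction n \<phi> (pi_map n x) = pi_map n (\<phi> x)"
proof -
  obtain h where h: "\<And>x. x \<in> carrier (Fn n) \<Longrightarrow> h (pi_map n x) = pi_map n (\<phi> x)"
    using reduction_exists[OF assms(1)] by metis
  have "(\<lambda>y. pi_map n (\<phi> y)) ` {y \<in> carrier (Fn n). pi_map n y = pi_map n x} = {pi_map n (\<phi> x)}"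
    using h assms(2) by (auto simp: image_iff) (metis h)+
  then show ?thesis using assms(2) by (simp add: induced_map_def)
qed

lemma reduction_ext: "reduction n \<phi> \<in> extensional (carrier (Hn n))"
  by (simp add: induced_map_def)

lemma reduction_eqI:
  assumes "\<phi> \<in> SymAut n" "f \<in> extensional (carrier (Hn n))"
    "\<And>x. x \<in> carrier (Fn n) \<Longrightarrow> f (pi_map n x) = pi_map n (\<phi> x)"
  shows "reduction n \<phi> = f"
proof (rule extensionalityI[OF reduction_ext assms(2)])
  fix z assume "z \<in> carrier (Hn n)"
  then obtain x where "x \<in> carrier (Fn n)" "pi_map n x = z" using pi_surj by blast
  then show "reduction n \<phi> z = f z" using assms reduction_pi by metis
qed

lemma reduction_hom:
  assumes "\<phi> \<in> SymAut n"
  shows "reduction n \<phi> \<in> hom (Hn n) (Hn n)"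
proof -
  obtain h where h: "h \<in> hom (Hn n) (Hn n)" "\<And>x. x \<in> carrier (Fn n) \<Longrightarrow> h (pi_map n x) = pi_map n (\<phi> x)"
    using reduction_exists[OF assms(1)] by metis
  have "reduction n \<phi> = restrict h (carrier (Hn n))"
    using h by (intro reduction_eqI assms) auto
  then show ?thesis using h(1) by (auto simp: hom_def H.m_closed)
qed

lemma reduction_mult_apply:
  assumes "\<phi> \<in> SymAut n" "\<psi> \<in> SymAut n" "z \<in> carrier (Hn n)"
  shows "reduction n (\<phi> \<otimes>\<^bsub>AutoGroup (Fn n)\<^esub> \<psi>) z = reduction n \<phi> (reduction n \<psi> z)"
proof -
  obtain x where x: "x \<in> carrier (Fn n)" "pi_map n x = z" using pi_surj assms(3) by blast
  have a: "\<phi> \<in> auto (Fn n)" "\<psi> \<in> auto (Fn n)" using assms sym_auto_subset by auto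
  show ?thesis
    using x(1) autoD(4)[OF a(2) x(1)]
    by (simp add: x(2)[symmetric] reduction_pi assms sym_auto_mult F.auto_mult_apply[OF a])
qed

lemma reduction_one: "reduction n \<one>\<^bsub>AutoGroup (Fn n)\<^esub> = (\<lambda>z\<in>carrier (Hn n). z)"
  using subgroup.one_closed[OF subgroup_SymAut]
  by (intro reduction_eqI) (auto simp: AutoGroup_simps(2))

text \<open>The inverse comes from the inverse of \<open>\<phi>\<close>, which is symmetric as well.\<close>

lemma reduction_auto:
  assumes "\<phi> \<in> SymAut n"
  shows "reduction n \<phi> \<in> auto (Hn n)"
proof -
  interpret A: group "AutoGroup (Fn n)" by (rule F.AutoGroup)
  let ?p = "inv\<^bsub>AutoGroup (Fn n)\<^esub> \<phi>"
  have p: "?p \<in> SymAut n" "\<phi> \<in> carrier (AutoGroup (Fn n))"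
    using sym_auto_inv[OF assms] assms sym_auto_subset by (auto simp: AutoGroup_simps(1))
  show ?thesis
  proof (rule autoI[OF reduction_hom[OF assms] reduction_hom[OF p(1)] reduction_ext])
    fix z assume z: "z \<in> carrier (Hn n)"
    show "reduction n \<phi> (reduction n ?p z) = z"
      using reduction_mult_apply[OF assms p(1) z] p(2) z by (simp add: reduction_one)
    show "reduction n ?p (reduction n \<phi> z) = z"
      using reduction_mult_apply[OF p(1) assms z] p(2) z by (simp add: reduction_one)
  qed
qed

lemma reduction_mult:
  assumes "\<phi> \<in> SymAut n" "\<psi> \<in> SymAut n"
  shows "reduction n (\<phi> \<otimes>\<^bsub>AutoGroup (Fn n)\<^esub> \<psi>) = reduction n \<phi> \<otimes>\<^bsub>AutoGroup (Hn n)\<^esub> reduction n \<psi>"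
proof (rule extensionalityI[OF reduction_ext])
  note a = reduction_auto[OF assms(1)] reduction_auto[OF assms(2)]
  show "reduction n \<phi> \<otimes>\<^bsub>AutoGroup (Hn n)\<^esub> reduction n \<psi> \<in> extensional (carrier (Hn n))"
    using autoD(3)[OF H.auto_mult_closed[OF a]] .
qed (simp add: reduction_mult_apply[OF assms] H.auto_mult_apply reduction_auto assms)

lemma reduction_inner:
  assumes "g \<in> carrier (Fn n)"
  shows "reduction n (inner (Fn n) g) = inner (Hn n) (pi_map n g)"
  using assms by (intro reduction_eqI inner_sym_auto) (auto simp: F.hom_inner[OF pi_map_hom group_Hn] inner_def)

lemma P_map_out_class:
  assumes "\<phi> \<in> SymAut n"
  shows "P_map n (out_class (Fn n) \<phi>) = out_class (Hn n) (reduction n \<phi>)"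
proof -
  have a: "\<phi> \<in> auto (Fn n)" using assms sym_auto_subset by auto
  have "out_class (Hn n) (reduction n (inner (Fn n) g \<otimes>\<^bsub>AutoGroup (Fn n)\<^esub> \<phi>)) = out_class (Hn n) (reduction n \<phi>)"
    if g: "g \<in> carrier (Fn n)" for g
    using g H.out_class_inner_mult[of "pi_map n g" n "reduction n \<phi>"] reduction_auto[OF assms]
    by (simp add: reduction_mult[OF inner_sym_auto[OF g] assms] reduction_inner)
  then have "(\<lambda>\<phi>. out_class (Hn n) (reduction n \<phi>)) ` out_class (Fn n) \<phi> = {out_class (Hn n) (reduction n \<phi>)}"
    unfolding F.out_class_eq[OF a] image_image using F.one_closed[of n] by auto
  then show ?thesis by (simp add: P_map_def)
qed

text \<open>The target is the full outer automorphism group of \<open>H\<^sub>n\<close>; it has the same unit as its subgroup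
\<open>SymOut(H\<^sub>n)\<close>, so this determines the same kernel.\<close>

lemma P_map_hom: "group_hom (SymOut_F n) (OutGroup (Hn n)) (P_map n)"
proof -
  interpret o: group_hom "SymAutGroup n" "SymOut_F n" "out_class (Fn n)"
    by (rule out_class_hom_SymOut)
  interpret h: group_hom "AutoGroup (Hn n)" "OutGroup (Hn n)" "out_class (Hn n)"
    by (rule H.out_class_group_hom)
  have car: "carrier (SymOut_F n) = out_class (Fn n) ` SymAut n" by (simp add: SymOut_def)
  have "P_map n \<in> hom (SymOut_F n) (OutGroup (Hn n))"
  proof (rule homI)
    fix C assume "C \<in> carrier (SymOut_F n)"
    then show "P_map n C \<in> carrier (OutGroup (Hn n))"
      using reduction_auto h.hom_closed by (auto simp: car P_map_out_class AutoGroup_simps(1))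
  next
    fix C D assume "C \<in> carrier (SymOut_F n)" "D \<in> carrier (SymOut_F n)"
    then obtain \<phi> \<psi> where p: "\<phi> \<in> SymAut n" "\<psi> \<in> SymAut n" "C = out_class (Fn n) \<phi>" "D = out_class (Fn n) \<psi>"
      by (auto simp: car)
    have "C \<otimes>\<^bsub>SymOut_F n\<^esub> D = out_class (Fn n) (\<phi> \<otimes>\<^bsub>AutoGroup (Fn n)\<^esub> \<psi>)"
      using o.hom_mult p by simp
    then show "P_map n (C \<otimes>\<^bsub>SymOut_F n\<^esub> D) = P_map n C \<otimes>\<^bsub>OutGroup (Hn n)\<^esub> P_map n D"
      using p reduction_auto h.hom_mult
      by (simp add: P_map_out_class sym_auto_mult reduction_mult AutoGroup_simps(1))
  qed
  then show ?thesis by (simp add: group_hom_def group_hom_axioms_def h.H.is_group o.H.is_group)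
qed

lemma kernel_P_map: "kernel (SymOut_F n) (SymOut_H n) (P_map n) = kernel (SymOut_F n) (OutGroup (Hn n)) (P_map n)"
  by (simp add: kernel_def SymOut_def)

lemma sym_auto_autoD: "\<phi> \<in> SymAut n \<Longrightarrow> \<phi> \<in> auto (Fn n)"
  by (simp add: sym_auto_def)

lemma sym_auto_closed: "\<phi> \<in> SymAut n \<Longrightarrow> x \<in> carrier (Fn n) \<Longrightarrow> \<phi> x \<in> carrier (Fn n)"
  by (rule autoD(4)[OF sym_auto_autoD])

lemma sym_auto_hom: "\<phi> \<in> SymAut n \<Longrightarrow> \<phi> \<in> hom (Fn n) (Fn n)"
  by (rule autoD(1)[OF sym_auto_autoD])

lemma sym_auto_mult_apply:
  "\<phi> \<in> SymAut n \<Longrightarrow> \<psi> \<in> SymAut n \<Longrightarrow> x \<in> carrier (Fn n) \<Longrightarrow>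
     (\<phi> \<otimes>\<^bsub>AutoGroup (Fn n)\<^esub> \<psi>) x = \<phi> (\<psi> x)"
  by (rule F.auto_mult_apply[OF sym_auto_autoD sym_auto_autoD])

lemma sym_auto_inner:
  "\<phi> \<in> SymAut n \<Longrightarrow> g \<in> carrier (Fn n) \<Longrightarrow> x \<in> carrier (Fn n) \<Longrightarrow>
     \<phi> (inner (Fn n) g x) = inner (Fn n) (\<phi> g) (\<phi> x)"
  by (rule F.hom_inner[OF sym_auto_hom F.is_group])

lemma sym_auto_m_inv:
  assumes "\<phi> \<in> SymAut n" "g \<in> carrier (Fn n)"
  shows "\<phi> (inv\<^bsub>Fn n\<^esub> g) = inv\<^bsub>Fn n\<^esub> (\<phi> g)"
  using group_hom.hom_inv[of "Fn n" "Fn n" \<phi> g] sym_auto_hom[OF assms(1)] assms(2)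
  by (simp add: group_hom_def group_hom_axioms_def F.is_group)

lemma sym_auto_eqI:
  "\<phi> \<in> SymAut n \<Longrightarrow> \<psi> \<in> SymAut n \<Longrightarrow> (\<And>i. i \<in> {1..n} \<Longrightarrow> \<phi> (ygen i) = \<psi> (ygen i)) \<Longrightarrow> \<phi> = \<psi>"
  by (rule auto_eq_on_gens[OF sym_auto_autoD sym_auto_autoD])

section \<open>Partial conjugations and inversions of generators\<close>

text \<open>The automorphism \<open>y\<^sub>i \<mapsto> y\<^sub>j y\<^sub>i y\<^sub>j\<inverse>\<close> for \<open>e = True\<close>, and its inverse for \<open>e = False\<close>.\<close>

definition partial_conj :: "nat \<Rightarrow> bool \<Rightarrow> nat \<Rightarrow> nat \<Rightarrow> (nat \<times> bool) list \<Rightarrow> (nat \<times> bool) list" where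
  "partial_conj n e i j =
     free_endo n (\<lambda>k. if k = i then inner (Fn n) [(j, e)] (ygen k) else ygen k)"

definition gen_inversion :: "nat \<Rightarrow> nat \<Rightarrow> (nat \<times> bool) list \<Rightarrow> (nat \<times> bool) list" where
  "gen_inversion n i = free_endo n (\<lambda>j. if j = i then inv\<^bsub>Fn n\<^esub> (ygen j) else ygen j)"

lemma rho_eq: "rho n i = out_class (Fn n) (gen_inversion n i)"
  by (simp add: rho_def gen_inversion_def free_endo_def)

lemma partial_conj_apply:
  assumes "j \<in> {1..n}" "k \<in> {1..n}"
  shows "partial_conj n e i j (ygen k) = (if k = i then inner (Fn n) [(j, e)] (ygen k) else ygen k)"
  unfolding partial_conj_def
  using assms by (subst free_endo(3)) (auto simp: F.inner_closed F.letter_in_carrier ygen_carrier)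

lemma gen_inversion_apply:
  assumes "k \<in> {1..n}"
  shows "gen_inversion n i (ygen k) = (if k = i then inv\<^bsub>Fn n\<^esub> (ygen k) else ygen k)"
  unfolding gen_inversion_def
  using assms by (subst free_endo(3)) (auto simp: ygen_carrier)

lemma partial_conj_sym:
  assumes ij: "i \<in> {1..n}" "j \<in> {1..n}" "i \<noteq> j"
  shows "partial_conj n e i j \<in> SymAut n"
proof -
  let ?f = "\<lambda>e k. if k = i then inner (Fn n) [(j, e)] (ygen k) else ygen k"
  have l: "[(j, b)] \<in> carrier (Fn n)" for b using ij by (simp add: F.letter_in_carrier)
  have c: "?f b k \<in> carrier (Fn n)" if "k \<in> {1..n}" for k b
    using that l ygen_carrier[OF that] by (auto intro!: F.inner_closed)
  have ll: "[(j, b)] \<otimes>\<^bsub>Fn n\<^esub> [(j, \<not> b)] = \<one>\<^bsub>Fn n\<^esub>" for b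
    using F.letter_cancel[of "(j, b)" n] ij by (simp add: inv_letter_def)
  have h: "partial_conj n b i j [(j, b')] = [(j, b')]" for b b'
    using hom_letter[OF F.is_group free_endo(1)[OF c] ij(2), where b = b'] letter_eq[OF ij(2), of b'] ij
      partial_conj_apply[OF ij(2,2)]
    by (simp add: partial_conj_def)
  have "free_endo n (?f b) (?f (\<not> b) k) = ygen k" if k: "k \<in> {1..n}" for k b
  proof -
    have e: "free_endo n (?f b) = partial_conj n b i j" by (simp add: partial_conj_def)
    have "inner (Fn n) [(j, \<not> b)] (inner (Fn n) [(j, b)] (ygen k)) = ygen k"
      using ll[of "\<not> b"] ygen_carrier[OF k] l by (simp add: F.inner_mult_apply F.inner_one)
    moreover have "partial_conj n b i j (inner (Fn n) [(j, \<not> b)] (ygen k))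
      = inner (Fn n) [(j, \<not> b)] (partial_conj n b i j (ygen k))"
      using F.hom_inner[OF free_endo(1)[OF c] F.is_group l[of "\<not> b"] ygen_carrier[OF k]] h[of b "\<not> b"]
      by (simp add: partial_conj_def)
    ultimately show ?thesis
      unfolding e using partial_conj_apply[OF ij(2) k] ij k by auto
  qed
  note inv = this and inv' = this[where b = "\<not> e", unfolded not_not]
  have "partial_conj n e i j \<in> auto (Fn n)"
    unfolding partial_conj_def
    by (rule free_endo_auto[of n "?f e" "?f (\<not> e)", OF c c inv]) (assumption | rule inv')+
  moreover have "\<exists>g\<in>carrier (Fn n). \<exists>x\<in>{1..n} \<times> UNIV. partial_conj n e i j (ygen k) = F.conj_letter n g x"
    if k: "k \<in> {1..n}" for k
  proof -
    have y: "ygen i = [(i, True)]" for i :: nat by (simp add: free_gen_def)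
    have "partial_conj n e i j (ygen k) = F.conj_letter n (if k = i then [(j, e)] else \<one>\<^bsub>Fn n\<^esub>) (k, True)"
      unfolding partial_conj_apply[OF ij(2) k]
      using ygen_carrier[OF k] by (auto simp: y inner_def F.conj_letter_def)
    moreover have "(if k = i then [(j, e)] else \<one>\<^bsub>Fn n\<^esub>) \<in> carrier (Fn n)" using l by simp
    moreover have "(k, True) \<in> {1..n} \<times> UNIV" using k by simp
    ultimately show ?thesis by blast
  qed
  ultimately show ?thesis using sym_auto_iff by blast
qed

lemma gen_inversion_sym:
  assumes i: "i \<in> {1..n}"
  shows "gen_inversion n i \<in> SymAut n"
proof -
  let ?f = "\<lambda>j. if j = i then inv\<^bsub>Fn n\<^esub> (ygen j) else ygen j"
  have c: "?f k \<in> carrier (Fn n)" if "k \<in> {1..n}" for k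
    using that ygen_carrier[OF that] by auto
  have "free_endo n ?f (?f k) = ygen k" if k: "k \<in> {1..n}" for k
  proof -
    interpret e: group_hom "Fn n" "Fn n" "free_endo n ?f"
      using free_endo(1)[OF c] F.is_group by (simp add: group_hom_def group_hom_axioms_def)
    show ?thesis using free_endo(3)[OF c k] ygen_carrier[OF k] by auto
  qed
  then have "gen_inversion n i \<in> auto (Fn n)"
    unfolding gen_inversion_def using free_endo_auto[of n ?f ?f] c by blast
  moreover have "\<exists>g\<in>carrier (Fn n). \<exists>x\<in>{1..n} \<times> UNIV. gen_inversion n i (ygen k) = F.conj_letter n g x"
    if k: "k \<in> {1..n}" for k
  proof -
    have "gen_inversion n i (ygen k) = F.conj_letter n \<one>\<^bsub>Fn n\<^esub> (k, k \<noteq> i)"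
      unfolding gen_inversion_apply[OF k] F.conj_letter_def letter_eq[OF k]
      using ygen_carrier[OF k] by auto
    moreover have "(k, k \<noteq> i) \<in> {1..n} \<times> UNIV" using k by simp
    ultimately show ?thesis using F.one_closed by blast
  qed
  ultimately show ?thesis using sym_auto_iff by blast
qed

abbreviation "pc n \<equiv> partial_conj n True"

lemma pc_apply:
  assumes "j \<in> {1..n}" "k \<in> {1..n}"
  shows "pc n i j (ygen k) = (if k = i then inner (Fn n) (ygen j) (ygen k) else ygen k)"
  using partial_conj_apply[OF assms] by (simp add: free_gen_def)

lemma pc_commute:
  assumes "i \<in> {1..n}" "j \<in> {1..n}" "k \<in> {1..n}" "l \<in> {1..n}"
    and "i \<noteq> j" "k \<noteq> l" "i \<noteq> k" "i \<noteq> l" "j \<noteq> k"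
  shows "pc n i j \<otimes>\<^bsub>AutoGroup (Fn n)\<^esub> pc n k l = pc n k l \<otimes>\<^bsub>AutoGroup (Fn n)\<^esub> pc n i j"
proof -
  note s = partial_conj_sym[OF assms(1,2,5), of True] partial_conj_sym[OF assms(3,4,6), of True]
  show ?thesis
  proof (rule sym_auto_eqI[OF sym_auto_mult[OF s] sym_auto_mult[OF s(2,1)]])
    fix m assume m: "m \<in> {1..n}"
    show "(pc n i j \<otimes>\<^bsub>AutoGroup (Fn n)\<^esub> pc n k l) (ygen m) = (pc n k l \<otimes>\<^bsub>AutoGroup (Fn n)\<^esub> pc n i j) (ygen m)"
      using assms m s ygen_carrier
      by (simp add: sym_auto_mult_apply pc_apply sym_auto_inner del: atLeastAtMost_iff)
  qed
qed

text \<open>Conjugating \<open>y\<^sub>i\<close> and \<open>y\<^sub>l\<close> simultaneously by \<open>y\<^sub>j\<close> commutes with conjugating \<open>y\<^sub>i\<close> by \<open>y\<^sub>l\<close>.\<close>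

lemma pc_triple:
  assumes "i \<in> {1..n}" "j \<in> {1..n}" "l \<in> {1..n}" "i \<noteq> j" "i \<noteq> l" "l \<noteq> j"
  shows "pc n i j \<otimes>\<^bsub>AutoGroup (Fn n)\<^esub> pc n l j \<otimes>\<^bsub>AutoGroup (Fn n)\<^esub> pc n i l
       = pc n i l \<otimes>\<^bsub>AutoGroup (Fn n)\<^esub> pc n i j \<otimes>\<^bsub>AutoGroup (Fn n)\<^esub> pc n l j"
proof -
  note s = partial_conj_sym[OF assms(1,2,4), of True] partial_conj_sym[OF assms(1,3,5), of True]
    partial_conj_sym[OF assms(3,2,6), of True]
  have t: "pc n i j \<otimes>\<^bsub>AutoGroup (Fn n)\<^esub> pc n l j \<in> SymAut n" "pc n i l \<otimes>\<^bsub>AutoGroup (Fn n)\<^esub> pc n i j \<in> SymAut n"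
    using s sym_auto_mult by blast+
  have c: "inner (Fn n) (ygen j) (ygen i) \<in> carrier (Fn n)" "inner (Fn n) (ygen j) (ygen l) \<in> carrier (Fn n)"
    "inner (Fn n) (ygen l) (ygen i) \<in> carrier (Fn n)"
    using assms ygen_carrier F.inner_closed by blast+
  have e: "inner (Fn n) (inner (Fn n) (ygen j) (ygen l)) (inner (Fn n) (ygen j) (ygen i))
      = inner (Fn n) (ygen j) (inner (Fn n) (ygen l) (ygen i))"
    using F.hom_inner[OF F.inner_hom F.is_group, of "ygen j" n "ygen l" "ygen i"] ygen_carrier assms by simp
  show ?thesis
  proof (rule sym_auto_eqI[OF sym_auto_mult[OF t(1) s(2)] sym_auto_mult[OF t(2) s(3)]])
    fix m assume m: "m \<in> {1..n}"
    show "(pc n i j \<otimes>\<^bsub>AutoGroup (Fn n)\<^esub> pc n l j \<otimes>\<^bsub>AutoGroup (Fn n)\<^esub> pc n i l) (ygen m)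
       = (pc n i l \<otimes>\<^bsub>AutoGroup (Fn n)\<^esub> pc n i j \<otimes>\<^bsub>AutoGroup (Fn n)\<^esub> pc n l j) (ygen m)"
      using assms m s t c ygen_carrier
      by (simp add: sym_auto_mult_apply pc_apply sym_auto_inner e del: atLeastAtMost_iff)
  qed
qed

lemma partial_conj_inverse:
  assumes "i \<in> {1..n}" "j \<in> {1..n}" "i \<noteq> j"
  shows "partial_conj n False i j \<otimes>\<^bsub>AutoGroup (Fn n)\<^esub> pc n i j = \<one>\<^bsub>AutoGroup (Fn n)\<^esub>"
proof -
  note s = partial_conj_sym[OF assms, of True] partial_conj_sym[OF assms, of False]
  have l: "[(j, False)] = inv\<^bsub>Fn n\<^esub> (ygen j)" "[(j, True)] = ygen j"
    using letter_eq[OF assms(2), of False] by (simp_all add: free_gen_def)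
  show ?thesis
  proof (rule sym_auto_eqI[OF sym_auto_mult[OF s(2,1)] subgroup.one_closed[OF subgroup_SymAut]])
    fix m assume m: "m \<in> {1..n}"
    show "(partial_conj n False i j \<otimes>\<^bsub>AutoGroup (Fn n)\<^esub> pc n i j) (ygen m) = \<one>\<^bsub>AutoGroup (Fn n)\<^esub> (ygen m)"
      using assms m s ygen_carrier
      by (simp add: sym_auto_mult_apply pc_apply partial_conj_apply sym_auto_inner l F.inner_mult_apply
            F.inner_one AutoGroup_simps(2) F.inner_closed del: atLeastAtMost_iff)
  qed
qed

lemma inversion_inverts_pc:
  assumes "i \<in> {1..n}" "j \<in> {1..n}" "i \<noteq> j"
  shows "gen_inversion n j \<otimes>\<^bsub>AutoGroup (Fn n)\<^esub> pc n i j \<otimes>\<^bsub>AutoGroup (Fn n)\<^esub> gen_inversion n j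
     = partial_conj n False i j"
proof -
  note s = partial_conj_sym[OF assms, of True] partial_conj_sym[OF assms, of False] gen_inversion_sym[OF assms(2)]
  have l: "[(j, False)] = inv\<^bsub>Fn n\<^esub> (ygen j)" "[(j, True)] = ygen j"
    using letter_eq[OF assms(2), of False] by (simp_all add: free_gen_def)
  have t: "gen_inversion n j \<otimes>\<^bsub>AutoGroup (Fn n)\<^esub> pc n i j \<in> SymAut n" using s sym_auto_mult by blast
  show ?thesis
  proof (rule sym_auto_eqI[OF sym_auto_mult[OF t s(3)] s(2)])
    fix m assume m: "m \<in> {1..n}"
    show "(gen_inversion n j \<otimes>\<^bsub>AutoGroup (Fn n)\<^esub> pc n i j \<otimes>\<^bsub>AutoGroup (Fn n)\<^esub> gen_inversion n j) (ygen m)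
     = partial_conj n False i j (ygen m)"
      using assms m s t ygen_carrier
      by (simp add: sym_auto_mult_apply pc_apply partial_conj_apply gen_inversion_apply sym_auto_inner l
            sym_auto_m_inv F.inner_closed del: atLeastAtMost_iff)
  qed
qed

section \<open>Length reduction in the free group\<close>

text \<open>Ping-pong: if no edge of the family is behind another one, also after inverting letters, then
the images of the generators move the base point into disjoint half trees, and the half tree of
the first letter of a word contains the image of the word.\<close>

lemma image_prefix:
  assumes \<phi>: "\<phi> \<in> auto (Fn n)"
    and b: "\<And>i. i \<in> {1..n} \<Longrightarrow> F.stem n (b i) (i, e i)"
    "\<And>i. i \<in> {1..n} \<Longrightarrow> \<phi> (ygen i) = F.conj_letter n (b i) (i, e i)"
    and free: "\<And>i j c. i \<in> {1..n} \<Longrightarrow> j \<in> {1..n} \<Longrightarrow> i \<noteq> j \<Longrightarrow> \<not> prefix (b j @ [(j, c)]) (b i)"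
    and w: "(i, c) # w \<in> carrier (Fn n)"
  shows "prefix (b i @ [(i, c = e i)]) (\<phi> ((i, c) # w))"
  using w
proof (induction w arbitrary: i c)
  note hom = autoD(1)[OF \<phi>]
  interpret p: group_hom "Fn n" "Fn n" \<phi>
    using hom F.is_group by (simp add: group_hom_def group_hom_axioms_def)
  have step: "prefix (b i @ [(i, c = e i)]) (\<phi> ((i, c) # w))"
    if w: "(i, c) # w \<in> carrier (Fn n)" and np: "\<not> prefix (b i @ [(i, c \<noteq> e i)]) (\<phi> w)" for i c w
  proof -
    have i: "i \<in> {1..n}" and wc: "w \<in> carrier (Fn n)" and l: "[(i, c)] \<in> carrier (Fn n)"
      using w by (auto simp: F.carrier_Cons_iff F.letter_in_carrier)
    have st: "F.stem n (b i) (i, c \<noteq> e i)"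
      using b(1)[OF i] F.stemD(3)[OF b(1)[OF i]] by (cases c; cases "e i") (auto simp: inv_letter_def)
    have f: "\<phi> [(i, c)] = F.conj_letter n (b i) (inv_letter (i, c \<noteq> e i))"
      using hom_letter_closed[OF hom i _ _ b(2)[OF i], of c] F.stemD(1,2)[OF b(1)[OF i]]
      by (cases c; cases "e i") (auto simp: inv_letter_def)
    have "\<phi> ((i, c) # w) = \<phi> [(i, c)] \<otimes>\<^bsub>Fn n\<^esub> \<phi> w"
      using F.Cons_mult[OF w] p.hom_mult[OF l wc] by simp
    then show ?thesis
      using F.flip_half_space[OF st p.hom_closed[OF wc] np] by (simp add: f) (simp add: inv_letter_def)
  qed
  {
    case Nil
    then show ?case using p.hom_one by (intro step) (auto simp: F.one_eq)
  next
    case (Cons y w)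
    obtain k d where y: "y = (k, d)" by (cases y)
    have c: "i \<in> {1..n}" "k \<in> {1..n}" "(k, d) # w \<in> carrier (Fn n)" "(k, d) \<noteq> (i, \<not> c)"
      using Cons.prems F.carrier_Cons_iff[of "(i, c)" "y # w" n] F.carrier_Cons_iff[of y w n]
      by (auto simp: y inv_letter_def)
    have IH: "prefix (b k @ [(k, d = e k)]) (\<phi> (y # w))" using Cons.IH[OF c(3)] by (simp add: y)
    have "\<not> prefix (b i @ [(i, c \<noteq> e i)]) (\<phi> (y # w))"
    proof
      assume q: "prefix (b i @ [(i, c \<noteq> e i)]) (\<phi> (y # w))"
      have ne: "(k, d = e k) \<noteq> (i, c \<noteq> e i)" using c(4) by auto
      show False
      proof (cases "k = i")
        case True
        then show ?thesis using prefix_same_cases[OF IH q] ne by auto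
      next
        case False
        then show ?thesis
          using F.prefix_comparable[OF IH q ne] free[OF c(1,2)] free[OF c(2,1)] by auto
      qed
    qed
    then show ?case by (rule step[OF Cons.prems])
  }
qed

text \<open>Some word is mapped to the single letter \<open>y\<^sub>k\<close>. This letter is in the half tree of some
generator \<open>i\<close>, which forces the stem of \<open>i\<close> to be empty and \<open>i = k\<close>.\<close>

lemma no_descent_imp_letters:
  assumes \<phi>: "\<phi> \<in> auto (Fn n)"
    and b: "\<And>i. i \<in> {1..n} \<Longrightarrow> F.stem n (b i) (i, e i)"
    "\<And>i. i \<in> {1..n} \<Longrightarrow> \<phi> (ygen i) = F.conj_letter n (b i) (i, e i)"
    and free: "\<And>i j c. i \<in> {1..n} \<Longrightarrow> j \<in> {1..n} \<Longrightarrow> i \<noteq> j \<Longrightarrow> \<not> prefix (b j @ [(j, c)]) (b i)"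
    and k: "k \<in> {1..n}"
  shows "\<phi> (ygen k) = [(k, e k)]"
proof -
  interpret p: group_hom "Fn n" "Fn n" \<phi>
    using autoD(1)[OF \<phi>] F.is_group by (simp add: group_hom_def group_hom_axioms_def)
  obtain w where w: "w \<in> carrier (Fn n)" "\<phi> w = ygen k"
    using bij_betw_imp_surj_on[OF autoD(2)[OF \<phi>]] ygen_carrier[OF k] by (metis imageE)
  have "w \<noteq> []" using w(2) p.hom_one by (auto simp: F.one_eq free_gen_def)
  then obtain i c v where v: "w = (i, c) # v" by (metis list.exhaust surj_pair)
  then have "prefix (b i @ [(i, c = e i)]) [(k, True)]"
    using image_prefix[OF \<phi> b free, where w = v and i = i and c = c] w by (simp add: free_gen_def)
  then have "b i = [] \<and> i = k" by (cases "b i") auto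
  then show ?thesis using b(2)[OF k] F.conj_letter_stem[OF b(1)[OF k]] by auto
qed

lemma pure_stems:
  assumes "\<phi> \<in> SymAut n"
    and "\<And>i. i \<in> {1..n} \<Longrightarrow> \<exists>g\<in>carrier (Fn n). \<exists>c. \<phi> (ygen i) = F.conj_letter n g (i, c)"
  obtains b e where "\<And>i. i \<in> {1..n} \<Longrightarrow> F.stem n (b i) (i, e i)"
    "\<And>i. i \<in> {1..n} \<Longrightarrow> \<phi> (ygen i) = F.conj_letter n (b i) (i, e i)"
proof -
  have "\<exists>b c. F.stem n b (i, c) \<and> \<phi> (ygen i) = F.conj_letter n b (i, c)" if i: "i \<in> {1..n}" for i
  proof -
    obtain g c where g: "g \<in> carrier (Fn n)" "\<phi> (ygen i) = F.conj_letter n g (i, c)"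
      using assms(2)[OF i] by blast
    have "(i, c) \<in> {1..n} \<times> UNIV" using i by simp
    then obtain b where "F.stem n b (i, c)" "F.conj_letter n b (i, c) = F.conj_letter n g (i, c)"
      using F.stem_exists[OF _ g(1)] by blast
    then show ?thesis using g(2) by metis
  qed
  then show ?thesis using that by metis
qed

section \<open>Rank and descents\<close>

text \<open>The representatives of elements of \<open>N\<close> that act trivially on \<open>H\<^sub>n\<close>. The aim is to show that the
second property implies the first. The intersection of both is normal, and multiplication with its
elements does not change the images in \<open>H\<^sub>n\<close>, so it can serve as the subgroup modulo which peaks
are eliminated.\<close>

definition core :: "nat \<Rightarrow> ((nat \<times> bool) list \<Rightarrow> (nat \<times> bool) list) set set \<Rightarrow> ((nat \<times> bool) list \<Rightarrow> (nat \<times> bool) list) set" where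
  "core n N = {\<phi> \<in> SymAut n. out_class (Fn n) \<phi> \<in> N \<and> reduction n \<phi> = (\<lambda>z\<in>carrier (Hn n). z)}"

lemma core_normal:
  assumes "N \<lhd> SymOut_F n"
  shows "core n N \<lhd> SymAutGroup n"
proof -
  interpret o: group_hom "SymAutGroup n" "SymOut_F n" "out_class (Fn n)"
    by (rule out_class_hom_SymOut)
  interpret r: group_hom "SymAutGroup n" "AutoGroup (Hn n)" "reduction n"
    using group_SymAut H.AutoGroup reduction_mult reduction_auto
    by (auto simp: group_hom_def group_hom_axioms_def hom_def AutoGroup_simps(1))
  have "core n N = {\<phi> \<in> carrier (SymAutGroup n). out_class (Fn n) \<phi> \<in> N} \<inter> kernel (SymAutGroup n) (AutoGroup (Hn n)) (reduction n)"
    by (auto simp: core_def kernel_def AutoGroup_simps(2))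
  then show ?thesis
    using o.G.normal_subgroup_intersect[OF o.normal_vimage[OF assms] r.normal_kernel] by simp
qed

lemma reduction_trivial_iff:
  assumes "\<phi> \<in> SymAut n"
  shows "reduction n \<phi> = (\<lambda>z\<in>carrier (Hn n). z) \<longleftrightarrow>
    (\<forall>i\<in>{1..n}. pi_map n (\<phi> (ygen i)) = zgen i)"
proof
  assume r: "reduction n \<phi> = (\<lambda>z\<in>carrier (Hn n). z)"
  show "\<forall>i\<in>{1..n}. pi_map n (\<phi> (ygen i)) = zgen i"
  proof
    fix i assume i: "i \<in> {1..n}"
    show "pi_map n (\<phi> (ygen i)) = zgen i"
      using reduction_pi[OF assms ygen_carrier[OF i]] pi_map_gen[OF i] zgen_carrier[OF i] by (simp add: r)
  qed
next
  assume a: "\<forall>i\<in>{1..n}. pi_map n (\<phi> (ygen i)) = zgen i"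
  have h: "pi_map n \<circ> \<phi> \<in> hom (Fn n) (Hn n)"
    using hom_compose[OF sym_auto_hom[OF assms] pi_map_hom] .
  have "pi_map n (\<phi> x) = pi_map n x" if "x \<in> carrier (Fn n)" for x
    using hom_eq_on_gens[OF group_Hn h pi_map_hom _ that] a by (simp add: pi_map_gen)
  then show "reduction n \<phi> = (\<lambda>z\<in>carrier (Hn n). z)"
    using assms by (intro reduction_eqI) auto
qed

lemma gen_inversion_core:
  assumes "i \<in> {1..n}" "rho n i \<in> N"
  shows "gen_inversion n i \<in> core n N"
proof -
  note s = gen_inversion_sym[OF assms(1)]
  have "pi_map n (gen_inversion n i (ygen k)) = zgen k" if k: "k \<in> {1..n}" for k
  proof -
    have "inv\<^bsub>Hn n\<^esub> (zgen k) = zgen k"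
      using H.inv_letter[of "(k, 1)" n] k by (simp add: zgen_def)
    then show ?thesis
      using k ygen_carrier[OF k] by (auto simp: gen_inversion_apply pi_map_gen simp del: atLeastAtMost_iff)
  qed
  then show ?thesis
    using s assms(2) reduction_trivial_iff[OF s] by (simp add: core_def rho_eq del: atLeastAtMost_iff)
qed

definition partial_conjs :: "nat \<Rightarrow> ((nat \<times> bool) list \<Rightarrow> (nat \<times> bool) list) set" where
  "partial_conjs n = {pc n i j | i j. i \<in> {1..n} \<and> j \<in> {1..n} \<and> i \<noteq> j}"

lemma partial_conjs_sym: "x \<in> partial_conjs n \<Longrightarrow> x \<in> SymAut n"
  by (auto simp: partial_conjs_def partial_conj_sym simp del: atLeastAtMost_iff)

abbreviation img :: "nat \<Rightarrow> ((nat \<times> bool) list \<Rightarrow> (nat \<times> bool) list) \<Rightarrow> nat \<Rightarrow> (nat \<times> int) list" where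
  "img n \<phi> i \<equiv> pi_map n (\<phi> (ygen i))"

lemma img_mult_pc:
  assumes "\<phi> \<in> SymAut n" "i \<in> {1..n}" "j \<in> {1..n}" "i \<noteq> j" "k \<in> {1..n}"
  shows "img n (\<phi> \<otimes>\<^bsub>AutoGroup (Fn n)\<^esub> pc n i j) k
     = (if k = i then inner (Hn n) (img n \<phi> j) (img n \<phi> k) else img n \<phi> k)"
  using assms ygen_carrier[OF assms(2)] ygen_carrier[OF assms(3)] ygen_carrier[OF assms(5)] sym_auto_closed[OF assms(1)]
  by (simp add: sym_auto_mult_apply partial_conj_sym pc_apply sym_auto_inner F.hom_inner[OF pi_map_hom group_Hn]
       del: atLeastAtMost_iff)

lemma img_mult_core:
  assumes "\<phi> \<in> SymAut n" "m \<in> core n N" "k \<in> {1..n}"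
  shows "img n (\<phi> \<otimes>\<^bsub>AutoGroup (Fn n)\<^esub> m) k = img n \<phi> k"
proof -
  have m: "m \<in> SymAut n" "reduction n m = (\<lambda>z\<in>carrier (Hn n). z)"
    using assms(2) by (auto simp: core_def)
  have "img n (\<phi> \<otimes>\<^bsub>AutoGroup (Fn n)\<^esub> m) k = reduction n \<phi> (img n m k)"
    using assms ygen_carrier[OF assms(3)] m(1)
    by (simp add: sym_auto_mult_apply reduction_pi sym_auto_closed)
  also have "img n m k = pi_map n (ygen k)"
    using reduction_trivial_iff[OF m(1)] m(2) assms(3) by (simp add: pi_map_gen del: atLeastAtMost_iff)
  also have "reduction n \<phi> (pi_map n (ygen k)) = img n \<phi> k"
    using reduction_pi[OF assms(1) ygen_carrier[OF assms(3)]] .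
  finally show ?thesis .
qed

text \<open>Every image is flipping one edge, from \<open>b i\<close> to \<open>b i\<close> followed by \<open>s i\<close>. The letters \<open>s i\<close> are
distinct because the generators are permuted.\<close>

lemma img_axes:
  assumes "\<phi> \<in> SymAut n"
  obtains b s where "\<And>i. i \<in> {1..n} \<Longrightarrow> H.stem n (b i) (s i)"
    "\<And>i. i \<in> {1..n} \<Longrightarrow> img n \<phi> i = H.conj_letter n (b i) (s i)"
    "\<And>i j. i \<in> {1..n} \<Longrightarrow> j \<in> {1..n} \<Longrightarrow> i \<noteq> j \<Longrightarrow> s i \<noteq> s j"
proof -
  have "\<exists>b s. H.stem n b s \<and> img n \<phi> i = H.conj_letter n b s" if i: "i \<in> {1..n}" for i
  proof -
    obtain g x where g: "g \<in> carrier (Fn n)" "x \<in> {1..n} \<times> UNIV" "\<phi> (ygen i) = F.conj_letter n g x"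
      using assms i sym_auto_iff by blast
    have m: "(fst x, 1) \<in> {1..n} \<times> {1}" "pi_map n g \<in> carrier (Hn n)" using g by auto
    obtain b where "H.stem n b (fst x, 1)" "H.conj_letter n b (fst x, 1) = H.conj_letter n (pi_map n g) (fst x, 1)"
      using H.stem_exists[OF m] by blast
    then show ?thesis using pi_conj_letter[OF g(1,2)] g(3) by metis
  qed
  then obtain b s where bs: "\<And>i. i \<in> {1..n} \<Longrightarrow> H.stem n (b i) (s i)"
    "\<And>i. i \<in> {1..n} \<Longrightarrow> img n \<phi> i = H.conj_letter n (b i) (s i)"
    by metis
  have p: "parity k (img n \<phi> i) = (if fst (s i) = k then 1 else 0)" if i: "i \<in> {1..n}" for i k
  proof -
    have "s i = (fst (s i), 1)" "fst (s i) \<in> {1..n}" "b i \<in> carrier (Hn n)"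
      using H.stemD(1,2)[OF bs(1)[OF i]] by auto
    then show ?thesis using bs(2)[OF i] parity_conj_letter by metis
  qed
  have "{1..n} \<subseteq> (\<lambda>i. fst (s i)) ` {1..n}"
  proof
    fix k assume k: "k \<in> {1..n}"
    obtain i g e where g: "i \<in> {1..n}" "g \<in> carrier (Fn n)" "\<phi> (ygen i) = F.conj_letter n g (k, e)"
      using sym_auto_onto[OF assms k] by blast
    have "img n \<phi> i = H.conj_letter n (pi_map n g) (k, 1)"
      using pi_conj_letter[OF g(2), of "(k, e)"] k g(3) by simp
    then have "parity k (img n \<phi> i) = 1"
      using parity_conj_letter[of "pi_map n g" n k k] g(2) k by simp
    then have "fst (s i) = k" using p[OF g(1), of k] by (simp split: if_splits)
    then show "k \<in> (\<lambda>i. fst (s i)) ` {1..n}" using g(1) by blast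
  qed
  moreover have "(\<lambda>i. fst (s i)) ` {1..n} \<subseteq> {1..n}"
    using H.stemD(2)[OF bs(1)] by fastforce
  ultimately have "(\<lambda>i. fst (s i)) ` {1..n} = {1..n}" by blast
  then have "inj_on (\<lambda>i. fst (s i)) {1..n}"
    by (intro eq_card_imp_inj_on) auto
  then have "s i \<noteq> s j" if "i \<in> {1..n}" "j \<in> {1..n}" "i \<noteq> j" for i j
    using that inj_onD by fastforce
  then show ?thesis using that bs by blast
qed

definition rank :: "nat \<Rightarrow> ((nat \<times> bool) list \<Rightarrow> (nat \<times> bool) list) \<Rightarrow> nat" where
  "rank n \<phi> = (\<Sum>i\<in>{1..n}. length (img n \<phi> i))"

lemma rank_less:
  assumes "\<And>i. i \<in> {1..n} \<Longrightarrow> length (img n \<phi> i) \<le> length (img n \<psi> i)"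
    and "i \<in> {1..n}" "length (img n \<phi> i) < length (img n \<psi> i)"
  shows "rank n \<phi> < rank n \<psi>"
  unfolding rank_def using assms by (intro sum_strict_mono_ex1) (auto simp del: atLeastAtMost_iff)

lemma descent:
  assumes b: "H.stem n (b i) (s i)" "H.stem n (b j) (s j)" "s i \<noteq> s j"
    and w: "w i = H.conj_letter n (b i) (s i)" "w j = H.conj_letter n (b j) (s j)"
  shows "prefix (b j @ [s j]) (b i) \<Longrightarrow> length (inner (Hn n) (w j) (w i)) < length (w i)"
    and "\<not> prefix (b j @ [s j]) (b i) \<Longrightarrow> length (w i) < length (inner (Hn n) (w j) (w i))"
proof -
  note c = H.stemD(1,2)[OF b(1)] H.stemD(1,2)[OF b(2)]
  have "inner (Hn n) (w j) (w i) = H.conj_letter n (H.conj_letter n (b j) (id (s j)) \<otimes>\<^bsub>Hn n\<^esub> b i) (s i)"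
    unfolding w inner_def using c H.conj_letter_closed by (subst H.conj_conj_letter[symmetric]) auto
  then show "prefix (b j @ [s j]) (b i) \<Longrightarrow> length (inner (Hn n) (w j) (w i)) < length (w i)"
    and "\<not> prefix (b j @ [s j]) (b i) \<Longrightarrow> length (w i) < length (inner (Hn n) (w j) (w i))"
    using H.conj_shortens[OF b(2,1)] H.conj_lengthens[OF b(2,1)] b(3) w(1) by auto
qed

text \<open>If the edge of \<open>i\<close> is behind the edge of \<open>l\<close>, and this one is behind the edge of \<open>j\<close>, then both
flips together remove the letters \<open>s l\<close> and \<open>s j\<close> from the stem of \<open>i\<close>, whatever further
cancellation takes place. The two flips need not be descents one after the other: cancellation
may bring the edge of \<open>i\<close> in front of the flipped edge of \<open>l\<close>.\<close>

lemma double_descent: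
  assumes b: "H.stem n (b i) (s i)" "H.stem n (b j) (s j)" "H.stem n (b l) (s l)"
    and w: "w i = H.conj_letter n (b i) (s i)" "w j = H.conj_letter n (b j) (s j)" "w l = H.conj_letter n (b l) (s l)"
    and p: "prefix (b j @ [s j]) (b l)" "prefix (b l @ [s l]) (b i)"
  shows "length (inner (Hn n) (w j) (inner (Hn n) (w l) (w i))) < length (w i)"
proof -
  note c = H.stemD(1,2)[OF b(1)] H.stemD(1,2)[OF b(2)] H.stemD(1,2)[OF b(3)]
  obtain d where d: "b l = b j @ [s j] @ d" using p(1) by (auto simp: prefix_def)
  obtain e where e: "b i = b l @ [s l] @ e" using p(2) by (auto simp: prefix_def)
  have car: "d \<in> carrier (Hn n)" "e \<in> carrier (Hn n)"
    using c(5) c(1) by (auto simp: d e H.carrier_append_iff H.carrier_Cons_iff)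
  note cl = H.conj_letter_closed[OF c(3,4)] H.conj_letter_closed[OF c(5,6)]
  let ?g = "w j \<otimes>\<^bsub>Hn n\<^esub> (w l \<otimes>\<^bsub>Hn n\<^esub> b i)"
  have wl: "w l \<otimes>\<^bsub>Hn n\<^esub> b i = b l \<otimes>\<^bsub>Hn n\<^esub> e"
    using H.conj_letter_mult_prefix[of "b l" "s l" e n] c(1) by (simp add: w(3) e)
  have "w j \<otimes>\<^bsub>Hn n\<^esub> b l = b j \<otimes>\<^bsub>Hn n\<^esub> d"
    using H.conj_letter_mult_prefix[of "b j" "s j" d n] c(5) by (simp add: w(2) d)
  then have g: "?g = b j \<otimes>\<^bsub>Hn n\<^esub> d \<otimes>\<^bsub>Hn n\<^esub> e"
    unfolding wl using c car cl by (simp add: w(2) H.m_assoc[symmetric])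
  have "length ?g \<le> length (b j \<otimes>\<^bsub>Hn n\<^esub> d) + length e"
    unfolding g using c car by (intro H.length_mult) auto
  also have "\<dots> \<le> length (b j) + length d + length e"
    using H.length_mult[OF c(3) car(1)] by simp
  finally have len: "length ?g < length (b i)" by (simp add: d e)
  have "inner (Hn n) (w j) (inner (Hn n) (w l) (w i)) = H.conj_letter n ?g (s i)"
    unfolding inner_def using c cl by (simp add: w H.conj_conj_letter H.conj_letter_closed)
  moreover have "length (H.conj_letter n ?g (s i)) \<le> 2 * length ?g + 1"
    using c cl by (intro H.length_conj_letter_le) (auto simp: w)
  ultimately show ?thesis using len H.length_conj_letter_stem[OF b(1)] by (simp add: w(1))
qed

section \<open>Symmetric automorphisms that act trivially on \<open>H\<^sub>n\<close>\<close>

context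
  fixes n :: nat and N
  assumes N: "N \<lhd> SymOut_F n" and rho: "\<And>i. i \<in> {1..n} \<Longrightarrow> rho n i \<in> N"
begin

interpretation M: group "SymAutGroup n" by (rule group_SymAut)

interpretation K: normal "core n N" "SymAutGroup n" by (rule core_normal[OF N])

abbreviation sym_comp (infixl "\<cdot>" 70) where "\<phi> \<cdot> \<psi> \<equiv> \<phi> \<otimes>\<^bsub>AutoGroup (Fn n)\<^esub> \<psi>"

text \<open>With \<open>r\<close> the inversion of \<open>y\<^sub>j\<close>, the inverse of \<open>x\<close> is \<open>r x r\<close>; hence \<open>x\<^sup>-\<^sup>2\<close> is the product of \<open>r\<close>
and a conjugate of \<open>r\<close>.\<close>

lemma partial_conj_square:
  assumes "x \<in> partial_conjs n"
  shows "x \<cdot> x \<in> core n N"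
proof -
  obtain i j where ij: "i \<in> {1..n}" "j \<in> {1..n}" "i \<noteq> j" and x: "x = pc n i j"
    using assms by (auto simp: partial_conjs_def simp del: atLeastAtMost_iff)
  let ?r = "gen_inversion n j" let ?y = "partial_conj n False i j"
  have r: "?r \<in> core n N" using gen_inversion_core ij(2) rho by blast
  have s: "x \<in> carrier (SymAutGroup n)" "?y \<in> carrier (SymAutGroup n)" "?r \<in> carrier (SymAutGroup n)"
    using partial_conj_sym[OF ij] gen_inversion_sym[OF ij(2)] by (simp_all add: x)
  have yx: "?y \<otimes>\<^bsub>SymAutGroup n\<^esub> x = \<one>\<^bsub>SymAutGroup n\<^esub>"
    using partial_conj_inverse[OF ij] by (simp add: x)
  have y: "?y = inv\<^bsub>SymAutGroup n\<^esub> x"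
    using M.inv_equality[OF yx s(1,2)] by simp
  (* ?r and its conjugate by x are in the core, and their product regroups to the square of ?y *)
  have "?r \<otimes>\<^bsub>SymAutGroup n\<^esub> (x \<otimes>\<^bsub>SymAutGroup n\<^esub> ?r \<otimes>\<^bsub>SymAutGroup n\<^esub> ?y) \<in> core n N"
    using r s K.inv_op_closed2[OF s(1) r] K.m_closed unfolding y by blast
  also have "?r \<otimes>\<^bsub>SymAutGroup n\<^esub> (x \<otimes>\<^bsub>SymAutGroup n\<^esub> ?r \<otimes>\<^bsub>SymAutGroup n\<^esub> ?y) =
    (?r \<otimes>\<^bsub>SymAutGroup n\<^esub> x \<otimes>\<^bsub>SymAutGroup n\<^esub> ?r) \<otimes>\<^bsub>SymAutGroup n\<^esub> ?y"
    using s by (simp only: M.m_assoc M.m_closed)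
  also have "\<dots> = ?y \<otimes>\<^bsub>SymAutGroup n\<^esub> ?y"
    using inversion_inverts_pc[OF ij] by (simp add: x)
  finally have "inv\<^bsub>SymAutGroup n\<^esub> (?y \<otimes>\<^bsub>SymAutGroup n\<^esub> ?y) \<in> core n N"
    by (rule K.m_inv_closed)
  moreover have "inv\<^bsub>SymAutGroup n\<^esub> (?y \<otimes>\<^bsub>SymAutGroup n\<^esub> ?y) = x \<otimes>\<^bsub>SymAutGroup n\<^esub> x"
    using M.inv_mult_group[OF s(2,2)] M.inv_inv[OF s(1)] unfolding y by simp
  ultimately show ?thesis by simp
qed

lemma rank_mult_core: "\<phi> \<in> SymAut n \<Longrightarrow> m \<in> core n N \<Longrightarrow> rank n (\<phi> \<cdot> m) = rank n \<phi>"
  unfolding rank_def by (intro sum.cong) (auto simp: img_mult_core simp del: atLeastAtMost_iff)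

lemma rank_mult_pc:
  assumes "\<phi> \<in> SymAut n" "i \<in> {1..n}" "j \<in> {1..n}" "i \<noteq> j"
  shows "length (inner (Hn n) (img n \<phi> j) (img n \<phi> i)) < length (img n \<phi> i) \<Longrightarrow> rank n (\<phi> \<cdot> pc n i j) < rank n \<phi>"
    and "length (img n \<phi> i) < length (inner (Hn n) (img n \<phi> j) (img n \<phi> i)) \<Longrightarrow> rank n \<phi> < rank n (\<phi> \<cdot> pc n i j)"
  using assms by (auto intro!: rank_less[where i = i] simp: img_mult_pc simp del: atLeastAtMost_iff)

lemma rank_descent:
  assumes "\<phi> \<in> SymAut n" "i \<in> {1..n}" "j \<in> {1..n}" "i \<noteq> j"
    and "H.stem n (b i) (s i)" "H.stem n (b j) (s j)" "s i \<noteq> s j"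
    and "img n \<phi> i = H.conj_letter n (b i) (s i)" "img n \<phi> j = H.conj_letter n (b j) (s j)"
  shows "if prefix (b j @ [s j]) (b i) then rank n (\<phi> \<cdot> pc n i j) < rank n \<phi> \<and>
       length (inner (Hn n) (img n \<phi> j) (img n \<phi> i)) < length (img n \<phi> i)
     else rank n \<phi> < rank n (\<phi> \<cdot> pc n i j)"
  using descent[where w = "img n \<phi>", OF assms(5-9)] rank_mult_pc[OF assms(1-4)] by auto

lemma rank_one_le: "\<phi> \<in> SymAut n \<Longrightarrow> rank n \<one>\<^bsub>SymAutGroup n\<^esub> \<le> rank n \<phi>"
proof -
  assume \<phi>: "\<phi> \<in> SymAut n"
  obtain b s where bs: "\<And>i. i \<in> {1..n} \<Longrightarrow> H.stem n (b i) (s i)"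
    "\<And>i. i \<in> {1..n} \<Longrightarrow> img n \<phi> i = H.conj_letter n (b i) (s i)"
    using img_axes[OF \<phi>] by metis
  have "length (img n \<one>\<^bsub>SymAutGroup n\<^esub> i) \<le> length (img n \<phi> i)" if i: "i \<in> {1..n}" for i
    using H.length_conj_letter_stem[OF bs(1)[OF i]] bs(2)[OF i] pi_map_gen[OF i] ygen_carrier[OF i]
    by (simp add: AutoGroup_simps(2) zgen_def)
  then show ?thesis unfolding rank_def by (rule sum_mono)
qed

text \<open>The edge of \<open>i\<close> is behind the edge of \<open>l\<close>, which is behind the edge of \<open>j\<close>. All three descents
\<open>\<chi>\<^sub>i\<^sub>j\<close>, \<open>\<chi>\<^sub>l\<^sub>j\<close>, \<open>\<chi>\<^sub>i\<^sub>l\<close> from \<open>a\<close> are joined through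
\<open>a \<chi>\<^sub>i\<^sub>j \<chi>\<^sub>l\<^sub>j \<chi>\<^sub>i\<^sub>l = a \<chi>\<^sub>i\<^sub>l \<chi>\<^sub>l\<^sub>j \<chi>\<^sub>i\<^sub>j\<close>, and all vertices on the way have smaller rank than \<open>a\<close>.\<close>

lemma triple_peak:
  assumes R: "\<And>b m. b \<in> R \<Longrightarrow> m \<in> core n N \<Longrightarrow> b \<cdot> m \<in> R"
      "\<And>b z. b \<in> R \<Longrightarrow> z \<in> partial_conjs n \<Longrightarrow> rank n (b \<cdot> z) < rank n a \<Longrightarrow> b \<cdot> z \<in> R"
    and a: "a \<in> SymAut n"
    and b: "\<And>i. i \<in> {1..n} \<Longrightarrow> H.stem n (b i) (s i)"
    "\<And>i. i \<in> {1..n} \<Longrightarrow> img n a i = H.conj_letter n (b i) (s i)"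
    "\<And>i j. i \<in> {1..n} \<Longrightarrow> j \<in> {1..n} \<Longrightarrow> i \<noteq> j \<Longrightarrow> s i \<noteq> s j"
    and ijl: "i \<in> {1..n}" "j \<in> {1..n}" "l \<in> {1..n}" "i \<noteq> j" "i \<noteq> l" "l \<noteq> j"
    and p: "prefix (b j @ [s j]) (b l)" "prefix (b l @ [s l]) (b i)"
  shows "a \<cdot> pc n i j \<in> R \<longleftrightarrow> a \<cdot> pc n l j \<in> R" "a \<cdot> pc n i j \<in> R \<longleftrightarrow> a \<cdot> pc n i l \<in> R"
proof -
  have T: "pc n i j \<in> partial_conjs n" "pc n l j \<in> partial_conjs n" "pc n i l \<in> partial_conjs n"
    using ijl by (auto simp: partial_conjs_def simp del: atLeastAtMost_iff)
  note S = T[THEN partial_conjs_sym]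
  have edge: "c \<in> R \<longleftrightarrow> c \<cdot> z \<in> R"
    if c: "c \<in> SymAut n" "z \<in> partial_conjs n" "rank n c < rank n a" "rank n (c \<cdot> z) < rank n a" for c z
  proof
    have z: "z \<in> SymAut n" using partial_conjs_sym c(2) by blast
    note zz = partial_conj_square[OF c(2)]
    have e: "c \<cdot> z \<cdot> z \<cdot> inv\<^bsub>SymAutGroup n\<^esub> (z \<cdot> z) = c"
      using M.m_assoc[of c z z] M.m_assoc[of c "z \<cdot> z" "inv\<^bsub>SymAutGroup n\<^esub> (z \<cdot> z)"]
        M.r_inv[of "z \<cdot> z"] M.inv_closed[of "z \<cdot> z"] M.r_one[of c] sym_auto_mult[OF z z] c z by simp
    have "c \<cdot> z \<cdot> z = c \<cdot> (z \<cdot> z)" using M.m_assoc[of c z z] c z by simp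
    then have rk: "rank n (c \<cdot> z \<cdot> z) < rank n a" using rank_mult_core[OF c(1) zz] c(3) by simp
    assume "c \<cdot> z \<in> R"
    then show "c \<in> R" using R(1)[OF R(2)[OF _ c(2) rk] K.m_inv_closed[OF zz]] e by simp
  qed (use R c in blast)
  have len: "length (inner (Hn n) (img n a j) (img n a l)) < length (img n a l)"
    "length (inner (Hn n) (img n a l) (img n a i)) < length (img n a i)"
    using rank_descent[OF a ijl(3,2,6) b(1)[OF ijl(3)] b(1)[OF ijl(2)] b(3)[OF ijl(3,2,6)] b(2)[OF ijl(3)] b(2)[OF ijl(2)]]
      rank_descent[OF a ijl(1,3,5) b(1)[OF ijl(1)] b(1)[OF ijl(3)] b(3)[OF ijl(1,3,5)] b(2)[OF ijl(1)] b(2)[OF ijl(3)]] p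
    by auto
  have pij: "prefix (b j @ [s j]) (b i)"
    using p by (metis append_prefixD prefix_order.trans)
  have lenij: "length (inner (Hn n) (img n a j) (img n a i)) < length (img n a i)"
    using rank_descent[OF a ijl(1,2,4) b(1)[OF ijl(1)] b(1)[OF ijl(2)] b(3)[OF ijl(1,2,4)] b(2)[OF ijl(1)] b(2)[OF ijl(2)]] pij
    by auto
  have len3: "length (inner (Hn n) (img n a j) (inner (Hn n) (img n a l) (img n a i))) < length (img n a i)"
    using double_descent[where w = "img n a", OF b(1)[OF ijl(1)] b(1)[OF ijl(2)] b(1)[OF ijl(3)]
        b(2)[OF ijl(1)] b(2)[OF ijl(2)] b(2)[OF ijl(3)] p] .
  (* ?m is the far corner of the triple relation; ?c1 and ?c2 are its neighbours on the two sides *)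
  let ?c1 = "a \<cdot> pc n i j \<cdot> pc n l j" let ?c2 = "a \<cdot> pc n i l \<cdot> pc n l j"
  let ?m = "?c2 \<cdot> pc n i j"
  have ax: "a \<cdot> pc n i j \<in> SymAut n" "a \<cdot> pc n l j \<in> SymAut n" "a \<cdot> pc n i l \<in> SymAut n"
    using S a sym_auto_mult by blast+
  have c: "?c1 \<in> SymAut n" "?c2 \<in> SymAut n" using S ax sym_auto_mult by blast+
  have com: "pc n i j \<cdot> pc n l j = pc n l j \<cdot> pc n i j"
    using pc_commute[of i n j l j] ijl by simp
  have c1: "?c1 = a \<cdot> pc n l j \<cdot> pc n i j"
    using M.m_assoc[of a "pc n i j" "pc n l j"] M.m_assoc[of a "pc n l j" "pc n i j"] S a com by simp
  have m: "?c1 \<cdot> pc n i l = ?m"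
  proof -
    have "?c1 \<cdot> pc n i l = a \<cdot> (pc n i j \<cdot> pc n l j \<cdot> pc n i l)"
      using M.m_assoc[of a "pc n i j" "pc n l j"] M.m_assoc[of a "pc n i j \<cdot> pc n l j" "pc n i l"] S a
        sym_auto_mult[OF S(1,2)] by simp
    also have "\<dots> = a \<cdot> (pc n i l \<cdot> pc n i j \<cdot> pc n l j)" using pc_triple[OF ijl] by simp
    also have "pc n i l \<cdot> pc n i j \<cdot> pc n l j = pc n i l \<cdot> (pc n l j \<cdot> pc n i j)"
      using M.m_assoc[of "pc n i l" "pc n i j" "pc n l j"] S com by simp
    also have "a \<cdot> (pc n i l \<cdot> (pc n l j \<cdot> pc n i j)) = ?m"
      using M.m_assoc[of a "pc n i l" "pc n l j \<cdot> pc n i j"] M.m_assoc[of "a \<cdot> pc n i l" "pc n l j" "pc n i j"] S a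
        ax sym_auto_mult[OF S(2,1)] by simp
    finally show ?thesis .
  qed
  note [simp] = img_mult_pc
  have r: "rank n (a \<cdot> pc n i j) < rank n a" "rank n (a \<cdot> pc n l j) < rank n a" "rank n (a \<cdot> pc n i l) < rank n a"
    using rank_mult_pc(1)[OF a] ijl lenij len by auto
  have rc: "rank n ?c1 < rank n a" "rank n ?c2 < rank n a" "rank n ?m < rank n a"
    using ijl lenij len len3 a ax c
    by (auto intro!: rank_less[where i = i] simp del: atLeastAtMost_iff)
  have "a \<cdot> pc n i j \<in> R \<longleftrightarrow> ?c1 \<in> R" using edge[OF ax(1) T(2) r(1) rc(1)] .
  moreover have "a \<cdot> pc n l j \<in> R \<longleftrightarrow> ?c1 \<in> R" using edge[OF ax(2) T(1) r(2)] rc(1) c1 by simp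
  moreover have "?c1 \<in> R \<longleftrightarrow> ?m \<in> R" using edge[OF c(1) T(3) rc(1)] rc(3) m by simp
  moreover have "?c2 \<in> R \<longleftrightarrow> ?m \<in> R" using edge[OF c(2) T(1) rc(2,3)] .
  moreover have "a \<cdot> pc n i l \<in> R \<longleftrightarrow> ?c2 \<in> R" using edge[OF ax(3) T(2) r(3) rc(2)] .
  ultimately show "a \<cdot> pc n i j \<in> R \<longleftrightarrow> a \<cdot> pc n l j \<in> R" "a \<cdot> pc n i j \<in> R \<longleftrightarrow> a \<cdot> pc n i l \<in> R"
    by blast+
qed

text \<open>The edges of \<open>i\<close> and \<open>k\<close> are behind those of \<open>j\<close> and \<open>l\<close>. If \<open>i = k\<close>, then the edges of \<open>j\<close> and \<open>l\<close>
are nested, since both separate the edge of \<open>i\<close> from the base point; if \<open>i = l\<close> or \<open>j = k\<close>, then three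
edges are nested by assumption. These cases are instances of the triple relation. In the
remaining case the two partial conjugations commute.\<close>

lemma peak_joined:
  assumes a: "a \<in> SymAut n" and xy: "x \<in> partial_conjs n" "y \<in> partial_conjs n"
    and lt: "rank n (a \<cdot> x) < rank n a" "rank n (a \<cdot> y) < rank n a"
    and R: "\<And>b m. b \<in> R \<Longrightarrow> m \<in> core n N \<Longrightarrow> b \<cdot> m \<in> R"
      "\<And>b z. b \<in> R \<Longrightarrow> z \<in> partial_conjs n \<Longrightarrow> rank n (b \<cdot> z) < rank n a \<Longrightarrow> b \<cdot> z \<in> R"
    and ax: "a \<cdot> x \<in> R"
  shows "a \<cdot> y \<in> R"
proof -
  obtain i j where x: "x = pc n i j" and ij: "i \<in> {1..n}" "j \<in> {1..n}" "i \<noteq> j"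
    using xy(1) unfolding partial_conjs_def by blast
  obtain k l where y: "y = pc n k l" and kl: "k \<in> {1..n}" "l \<in> {1..n}" "k \<noteq> l"
    using xy(2) unfolding partial_conjs_def by blast
  obtain b s where b: "\<And>i. i \<in> {1..n} \<Longrightarrow> H.stem n (b i) (s i)"
    "\<And>i. i \<in> {1..n} \<Longrightarrow> img n a i = H.conj_letter n (b i) (s i)"
    "\<And>i j. i \<in> {1..n} \<Longrightarrow> j \<in> {1..n} \<Longrightarrow> i \<noteq> j \<Longrightarrow> s i \<noteq> s j"
    using img_axes[OF a] by metis
  note d1 = rank_descent[OF a ij b(1)[OF ij(1)] b(1)[OF ij(2)] b(3)[OF ij] b(2)[OF ij(1)] b(2)[OF ij(2)]]
  note d2 = rank_descent[OF a kl b(1)[OF kl(1)] b(1)[OF kl(2)] b(3)[OF kl] b(2)[OF kl(1)] b(2)[OF kl(2)]]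
  have p1: "prefix (b j @ [s j]) (b i)" and len1: "length (inner (Hn n) (img n a j) (img n a i)) < length (img n a i)"
    using d1 lt(1) by (auto simp: x split: if_splits)
  have p2: "prefix (b l @ [s l]) (b k)" and len2: "length (inner (Hn n) (img n a l) (img n a k)) < length (img n a k)"
    using d2 lt(2) by (auto simp: y split: if_splits)
  have triple: "a \<cdot> pc n i j \<in> R \<longleftrightarrow> a \<cdot> pc n l j \<in> R" "a \<cdot> pc n i j \<in> R \<longleftrightarrow> a \<cdot> pc n i l \<in> R"
    if ijl: "i \<in> {1..n}" "j \<in> {1..n}" "l \<in> {1..n}" "i \<noteq> j" "i \<noteq> l" "l \<noteq> j"
      and p: "prefix (b j @ [s j]) (b l)" "prefix (b l @ [s l]) (b i)" for i j l
    by (rule triple_peak[where R = R and b = b and s = s]; fact R a b ijl p)+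
  consider "i = k" "j = l" | "i = k" "j \<noteq> l" | "i \<noteq> k" "i = l" "j = k" | "i \<noteq> k" "i = l" "j \<noteq> k"
    | "i \<noteq> k" "i \<noteq> l" "j = k" | "i \<noteq> k" "i \<noteq> l" "j \<noteq> k" by blast
  then show ?thesis
  proof cases
    case 1
    then show ?thesis using ax x y by simp
  next
    case 2
    have "prefix (b j @ [s j]) (b l) \<or> prefix (b l @ [s l]) (b j)"
      using H.prefix_comparable[OF p1, of "b l" "s l"] p2 2 b(3)[OF ij(2) kl(2)] by auto
    moreover have q: "i \<noteq> l" "l \<noteq> j" "j \<noteq> l" "prefix (b l @ [s l]) (b i)" using 2 kl p2 by auto
    ultimately have "a \<cdot> pc n i j \<in> R \<longleftrightarrow> a \<cdot> pc n i l \<in> R"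
      using triple(2)[OF ij(1,2) kl(2) ij(3) q(1,2) _ q(4)] triple(2)[OF ij(1) kl(2) ij(2) q(1) ij(3) q(3) _ p1]
      by blast
    then show ?thesis using ax 2 by (simp add: x y)
  next
    case 3
    then have "length (b j) < length (b i)" "length (b i) < length (b j)"
      using prefix_length_le[OF p1] prefix_length_le[OF p2] by auto
    then show ?thesis by simp
  next
    case 4
    then have q: "k \<noteq> j" "k \<noteq> i" "prefix (b i @ [s i]) (b k)" using p2 by auto
    show ?thesis
      using triple[OF kl(1) ij(2,1) q(1,2) ij(3) p1 q(3)] ax 4 by (simp add: x y)
  next
    case 5
    then have q: "j \<noteq> l" "prefix (b l @ [s l]) (b j)" using p2 kl by auto
    show ?thesis
      using triple[OF ij(1) kl(2) ij(2) 5(2) ij(3) q p1] ax 5 by (simp add: x y)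
  next
    case 6
    have S: "x \<in> SymAut n" "y \<in> SymAut n" using xy partial_conjs_sym by blast+
    have axy: "a \<cdot> x \<in> SymAut n" "a \<cdot> y \<in> SymAut n" using S a sym_auto_mult by blast+
    have "x \<cdot> y = y \<cdot> x" unfolding x y using pc_commute 6 ij kl by blast
    then have c: "a \<cdot> x \<cdot> y = a \<cdot> y \<cdot> x"
      using M.m_assoc[of a x y] M.m_assoc[of a y x] S a by simp
    have "rank n (a \<cdot> x \<cdot> y) < rank n a"
      using ij kl len1 len2 a axy 6 unfolding x y
      by (auto intro!: rank_less[where i = i] simp: img_mult_pc simp del: atLeastAtMost_iff)
    then have "a \<cdot> y \<cdot> x \<in> R" using R(2)[OF ax xy(2)] c by simp
    moreover note zz = partial_conj_square[OF xy(1)]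
    have e: "a \<cdot> y \<cdot> x \<cdot> x = a \<cdot> y \<cdot> (x \<cdot> x)" using M.m_assoc[of "a \<cdot> y" x x] axy S by simp
    moreover have "rank n (a \<cdot> y \<cdot> (x \<cdot> x)) < rank n a"
      using rank_mult_core[OF axy(2) zz] lt(2) by simp
    ultimately have "a \<cdot> y \<cdot> (x \<cdot> x) \<in> R" using R(2)[OF _ xy(1), of "a \<cdot> y \<cdot> x"] by simp
    then have "a \<cdot> y \<cdot> (x \<cdot> x) \<cdot> inv\<^bsub>SymAutGroup n\<^esub> (x \<cdot> x) \<in> R"
      using R(1) K.m_inv_closed[OF zz] by blast
    then show ?thesis
      using M.m_assoc[of "a \<cdot> y" "x \<cdot> x" "inv\<^bsub>SymAutGroup n\<^esub> (x \<cdot> x)"] M.r_inv[of "x \<cdot> x"]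
        M.inv_closed[of "x \<cdot> x"] M.r_one[of "a \<cdot> y"] sym_auto_mult[OF S(1,1)] axy by simp
  qed
qed

lemma peaks_SymAut: "peaks (core n N) (SymAutGroup n) (partial_conjs n) (rank n)"
proof (intro peaks.intro peaks_axioms.intro)
  show "core n N \<lhd> SymAutGroup n" by (rule core_normal[OF N])
  show "partial_conjs n \<subseteq> carrier (SymAutGroup n)" using partial_conjs_sym by auto
  show "rank n (a \<otimes>\<^bsub>SymAutGroup n\<^esub> x) \<noteq> rank n a"
    if a: "a \<in> carrier (SymAutGroup n)" and x: "x \<in> partial_conjs n" for a x
  proof -
    obtain i j where x: "x = pc n i j" and ij: "i \<in> {1..n}" "j \<in> {1..n}" "i \<noteq> j"
      using x unfolding partial_conjs_def by blast
    have a: "a \<in> SymAut n" using a by simp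
    obtain b s where b: "\<And>i. i \<in> {1..n} \<Longrightarrow> H.stem n (b i) (s i)"
      "\<And>i. i \<in> {1..n} \<Longrightarrow> img n a i = H.conj_letter n (b i) (s i)"
      "\<And>i j. i \<in> {1..n} \<Longrightarrow> j \<in> {1..n} \<Longrightarrow> i \<noteq> j \<Longrightarrow> s i \<noteq> s j"
      using img_axes[OF a] by metis
    show ?thesis
      using rank_descent[OF a ij b(1)[OF ij(1)] b(1)[OF ij(2)] b(3)[OF ij] b(2)[OF ij(1)] b(2)[OF ij(2)]]
      by (auto simp: x split: if_splits)
  qed
  show "a \<otimes>\<^bsub>SymAutGroup n\<^esub> y \<in> R"
    if "a \<in> carrier (SymAutGroup n)" "x \<in> partial_conjs n" "y \<in> partial_conjs n"
      "rank n (a \<otimes>\<^bsub>SymAutGroup n\<^esub> x) < rank n a" "rank n (a \<otimes>\<^bsub>SymAutGroup n\<^esub> y) < rank n a"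
      "\<And>b m. b \<in> R \<Longrightarrow> m \<in> core n N \<Longrightarrow> b \<otimes>\<^bsub>SymAutGroup n\<^esub> m \<in> R"
      "\<And>b z. b \<in> R \<Longrightarrow> z \<in> partial_conjs n \<Longrightarrow> rank n (b \<otimes>\<^bsub>SymAutGroup n\<^esub> z) < rank n a \<Longrightarrow> b \<otimes>\<^bsub>SymAutGroup n\<^esub> z \<in> R"
      "a \<otimes>\<^bsub>SymAutGroup n\<^esub> x \<in> R" for a x y R
    using peak_joined[of a x y R] that by simp
qed (use rank_mult_core partial_conj_square rank_one_le in auto)

interpretation Q: peaks "core n N" "SymAutGroup n" "partial_conjs n" "rank n"
  by (rule peaks_SymAut)

text \<open>The products of partial conjugations and elements of the core.\<close>

definition reach where
  "reach = (\<Union>r. below (SymAutGroup n) (core n N) (partial_conjs n) (rank n) r)"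

lemma reach_core: "\<phi> \<in> reach \<Longrightarrow> m \<in> core n N \<Longrightarrow> \<phi> \<cdot> m \<in> reach"
  unfolding reach_def using below_coset[of _ "SymAutGroup n" "core n N"] by fastforce

lemma reach_pc: "\<phi> \<in> reach \<Longrightarrow> x \<in> partial_conjs n \<Longrightarrow> \<phi> \<cdot> x \<in> reach"
proof -
  assume "\<phi> \<in> reach" and x: "x \<in> partial_conjs n"
  then obtain r where "\<phi> \<in> below (SymAutGroup n) (core n N) (partial_conjs n) (rank n) r"
    unfolding reach_def by blast
  then have "\<phi> \<in> below (SymAutGroup n) (core n N) (partial_conjs n) (rank n) (r + Suc (rank n (\<phi> \<cdot> x)))"
    by (rule below_mono) simp
  then have "\<phi> \<cdot> x \<in> below (SymAutGroup n) (core n N) (partial_conjs n) (rank n) (r + Suc (rank n (\<phi> \<cdot> x)))"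
    using below_step[OF _ x, where G = "SymAutGroup n"] by simp
  then show ?thesis unfolding reach_def by blast
qed

lemma core_SymAut: "m \<in> core n N \<Longrightarrow> m \<in> SymAut n"
  by (simp add: core_def)

lemma reach_cancel_core:
  assumes "\<phi> \<in> SymAut n" "m \<in> core n N" "\<phi> \<cdot> m \<in> reach"
  shows "\<phi> \<in> reach"
  using reach_core[OF assms(3) K.m_inv_closed[OF assms(2)]]
    M.m_assoc[of \<phi> m "inv\<^bsub>SymAutGroup n\<^esub> m"] M.r_inv[of m] M.r_one[of \<phi>]
    M.inv_closed[of m] core_SymAut[OF assms(2)] assms(1) by simp

lemma reach_cancel_pc:
  assumes "\<phi> \<in> SymAut n" "x \<in> partial_conjs n" "\<phi> \<cdot> x \<in> reach"
  shows "\<phi> \<in> reach"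
proof -
  have "\<phi> \<cdot> (x \<cdot> x) = \<phi> \<cdot> x \<cdot> x"
    using M.m_assoc[of \<phi> x x] assms partial_conjs_sym by simp
  then have "\<phi> \<cdot> (x \<cdot> x) \<in> reach" using reach_pc[OF assms(3,2)] by simp
  then show ?thesis using reach_cancel_core[OF assms(1)] Q.square[OF assms(2)] by simp
qed

lemma letters_reach:
  assumes "\<phi> \<in> SymAut n" "\<And>i. i \<in> {1..n} \<Longrightarrow> \<phi> (ygen i) = [(i, e i)]"
  shows "\<phi> \<in> reach"
  using assms
proof (induction "card {i \<in> {1..n}. \<not> e i}" arbitrary: e \<phi>)
  case 0
  then have "e i" if "i \<in> {1..n}" for i using that by (auto simp: card_eq_0_iff simp del: atLeastAtMost_iff)
  then have "\<phi> = \<one>\<^bsub>AutoGroup (Fn n)\<^esub>"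
  proof (intro sym_auto_eqI[OF "0.prems"(1) subgroup.one_closed[OF subgroup_SymAut]])
    fix i assume i: "i \<in> {1..n}"
    have "\<phi> (ygen i) = ygen i" using "0.prems"(2)[OF i] \<open>\<And>i. i \<in> {1..n} \<Longrightarrow> e i\<close>[OF i] by (simp add: free_gen_def)
    then show "\<phi> (ygen i) = \<one>\<^bsub>AutoGroup (Fn n)\<^esub> (ygen i)" using ygen_carrier[OF i] by (simp add: AutoGroup_simps(2))
  qed
  then show ?case using below_one[of "SymAutGroup n"] by (auto simp: reach_def)
next
  case (Suc c)
  have "{i \<in> {1..n}. \<not> e i} \<noteq> {}"
  proof
    assume "{i \<in> {1..n}. \<not> e i} = {}"
    then have "card {i \<in> {1..n}. \<not> e i} = 0" by (simp only: card.empty)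
    then show False using Suc.hyps(2) by linarith
  qed
  then obtain i where i: "i \<in> {1..n}" "\<not> e i" by blast
  let ?e = "e(i := True)"
  have "{k \<in> {1..n}. \<not> ?e k} = {k \<in> {1..n}. \<not> e k} - {i}" by auto
  then have card: "c = card {k \<in> {1..n}. \<not> ?e k}"
    using Suc.hyps(2) i by (simp add: card_Diff_singleton)
  have s: "gen_inversion n i \<in> SymAut n" by (rule gen_inversion_sym[OF i(1)])
  have inv: "inv\<^bsub>Fn n\<^esub> [(i, False)] = [(i, True)]"
    using F.inv_letter[of "(i, False)" n] i by (simp add: inv_letter_def)
  have "(\<phi> \<cdot> gen_inversion n i) (ygen k) = [(k, ?e k)]" if k: "k \<in> {1..n}" for k
    using Suc.prems(2)[OF k] i inv k s ygen_carrier[OF k] Suc.prems(1)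
    by (auto simp: sym_auto_mult_apply gen_inversion_apply sym_auto_m_inv simp del: atLeastAtMost_iff)
  then have "\<phi> \<cdot> gen_inversion n i \<in> reach"
    using Suc.hyps(1)[OF card sym_auto_mult[OF Suc.prems(1) s]] by simp
  then show ?case
    using reach_cancel_core[OF Suc.prems(1)] gen_inversion_core[OF i(1) rho[OF i(1)]] by blast
qed

text \<open>Induction on the total length of the images of the generators. If the edge of \<open>i\<close> is behind an
edge of \<open>j\<close>, a partial conjugation or its inverse makes the image of \<open>y\<^sub>i\<close> shorter; otherwise all
stems are empty and inversions suffice.\<close>

lemma pure_reach:
  assumes "\<phi> \<in> SymAut n"
    and "\<And>i. i \<in> {1..n} \<Longrightarrow> \<exists>g\<in>carrier (Fn n). \<exists>c. \<phi> (ygen i) = F.conj_letter n g (i, c)"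
  shows "\<phi> \<in> reach"
  using assms
proof (induction "\<Sum>i\<in>{1..n}. length (\<phi> (ygen i))" arbitrary: \<phi> rule: less_induct)
  case less
  obtain b e where b: "\<And>i. i \<in> {1..n} \<Longrightarrow> F.stem n (b i) (i, e i)"
    "\<And>i. i \<in> {1..n} \<Longrightarrow> \<phi> (ygen i) = F.conj_letter n (b i) (i, e i)"
    using pure_stems[OF less.prems] by metis
  show ?case
  proof (cases "\<exists>i j c. i \<in> {1..n} \<and> j \<in> {1..n} \<and> i \<noteq> j \<and> prefix (b j @ [(j, c)]) (b i)")
    case False
    then have "\<phi> (ygen k) = [(k, e k)]" if "k \<in> {1..n}" for k
      using no_descent_imp_letters[OF sym_auto_autoD[OF less.prems(1)] b] that by blast
    then show ?thesis using letters_reach[OF less.prems(1)] by blast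
  next
    case True
    then obtain i j c where ij: "i \<in> {1..n}" "j \<in> {1..n}" "i \<noteq> j" and p: "prefix (b j @ [(j, c)]) (b i)"
      by blast
    (* the exponent is chosen such that the image of the conjugator flips the edge of the letter (j, c) *)
    let ?x = "partial_conj n (c \<noteq> e j) i j"
    let ?\<psi> = "\<phi> \<cdot> ?x"
    note x = partial_conj_sym[OF ij]
    have st: "F.stem n (b j) (j, c)"
      using b(1)[OF ij(2)] F.stemD(3)[OF b(1)[OF ij(2)]] by (cases c; cases "e j") (auto simp: inv_letter_def)
    have bc: "b i \<in> carrier (Fn n)" "b j \<in> carrier (Fn n)" using F.stemD(1)[OF b(1)] ij by auto
    have l: "[(j, c \<noteq> e j)] \<in> carrier (Fn n)" using ij by (simp add: F.letter_in_carrier)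
    let ?u = "F.conj_letter n (b j) (inv_letter (j, c))"
    have u: "\<phi> [(j, c \<noteq> e j)] = ?u"
      using hom_letter_closed[OF sym_auto_hom[OF less.prems(1)] ij(2) bc(2) _ b(2)[OF ij(2)], of "c \<noteq> e j"] ij
      by (cases c; cases "e j") (auto simp: inv_letter_def)
    have uc: "?u \<in> carrier (Fn n)" using u sym_auto_closed[OF less.prems(1) l] by simp
    have img: "?\<psi> (ygen k) = (if k = i then inner (Fn n) ?u (\<phi> (ygen k)) else \<phi> (ygen k))"
      if k: "k \<in> {1..n}" for k
      using k ij x ygen_carrier[OF k] ygen_carrier[OF ij(1)] less.prems(1) l u
      by (simp add: sym_auto_mult_apply partial_conj_apply sym_auto_inner del: atLeastAtMost_iff)
    have img_i: "?\<psi> (ygen i) = F.conj_letter n (?u \<otimes>\<^bsub>Fn n\<^esub> b i) (i, e i)"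
      using img[OF ij(1)] b(2)[OF ij(1)] uc bc ij F.conj_conj_letter[OF uc bc(1), of "(i, e i)"]
        F.conj_letter_closed[OF bc(1), of "(i, e i)"]
      by (simp add: inner_def)
    have "length (?\<psi> (ygen i)) < length (\<phi> (ygen i))"
      using F.conj_shortens[OF st b(1)[OF ij(1)] p] b(2)[OF ij(1)] by (simp only: img_i)
    then have len: "(\<Sum>k\<in>{1..n}. length (?\<psi> (ygen k))) < (\<Sum>k\<in>{1..n}. length (\<phi> (ygen k)))"
      using ij(1) img by (intro sum_strict_mono_ex1) (auto simp del: atLeastAtMost_iff)
    have "\<exists>g\<in>carrier (Fn n). \<exists>c. ?\<psi> (ygen k) = F.conj_letter n g (k, c)" if k: "k \<in> {1..n}" for k
    proof (cases "k = i")
      case True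
      then show ?thesis using img_i F.m_closed[OF uc bc(1)] by blast
    next
      case False
      then show ?thesis using img[OF k] less.prems(2)[OF k] by simp
    qed
    then have \<psi>: "?\<psi> \<in> reach"
      using less.hyps[OF len sym_auto_mult[OF less.prems(1) x]] by blast
    have pc: "pc n i j \<in> partial_conjs n" using ij unfolding partial_conjs_def by blast
    show ?thesis
    proof (cases "c \<noteq> e j")
      case True
      then show ?thesis using \<psi> reach_cancel_pc[OF less.prems(1) pc] by simp
    next
      case False
      have "?\<psi> \<cdot> pc n i j = \<phi> \<cdot> (?x \<cdot> pc n i j)"
        using M.m_assoc[of \<phi> ?x "pc n i j"] x less.prems(1) partial_conjs_sym[OF pc] by simp
      also have "?x \<cdot> pc n i j = \<one>\<^bsub>SymAutGroup n\<^esub>"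
        using partial_conj_inverse[OF ij] False by simp
      also have "\<phi> \<cdot> \<one>\<^bsub>SymAutGroup n\<^esub> = \<phi>" using M.r_one[of \<phi>] less.prems(1) by simp
      finally show ?thesis using reach_pc[OF \<psi> pc] by simp
    qed
  qed
qed

text \<open>Parity shows that \<open>\<phi>\<close> fixes the conjugacy classes of the generators up to inversion, so that
\<open>\<phi>\<close> is a product as above. Its rank is the minimal one, and peak elimination applies.\<close>

lemma trivial_reduction_in_core:
  assumes \<phi>: "\<phi> \<in> SymAut n" and r: "reduction n \<phi> = (\<lambda>z\<in>carrier (Hn n). z)"
  shows "\<phi> \<in> core n N"
proof -
  have img: "img n \<phi> i = zgen i" if "i \<in> {1..n}" for i
    using reduction_trivial_iff[OF \<phi>] r that by blast
  have "\<exists>g\<in>carrier (Fn n). \<exists>c. \<phi> (ygen i) = F.conj_letter n g (i, c)" if i: "i \<in> {1..n}" for i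
  proof -
    obtain g x where g: "g \<in> carrier (Fn n)" "x \<in> {1..n} \<times> UNIV" "\<phi> (ygen i) = F.conj_letter n g x"
      using \<phi> i sym_auto_iff by blast
    have fx: "fst x \<in> {1..n}" using g(2) by auto
    have "parity (fst x) (zgen i) = 1"
      using parity_conj_letter[OF pi.hom_closed[OF g(1)] fx, of "fst x"] pi_conj_letter[OF g(1,2)] g(3) img[OF i]
      by simp
    then have "fst x = i" by (simp add: parity_def zgen_def integer_mod_group_def split: if_splits)
    then show ?thesis using g by (metis prod.collapse)
  qed
  then have "\<phi> \<in> reach" using pure_reach[OF \<phi>] by blast
  then obtain r where r: "\<phi> \<in> below (SymAutGroup n) (core n N) (partial_conjs n) (rank n) r"
    unfolding reach_def by blast
  have "rank n \<phi> = rank n \<one>\<^bsub>SymAutGroup n\<^esub>"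
    unfolding rank_def using img pi_map_gen ygen_carrier
    by (intro sum.cong) (auto simp: AutoGroup_simps(2) simp del: atLeastAtMost_iff)
  then show ?thesis by (rule Q.connected_imp_mem[OF r])
qed

end

section \<open>The kernel of \<open>\<P>\<^sub>n\<close>\<close>

theorem proposition1p4:
  fixes n :: nat
  assumes "n \<ge> 2"
  shows "kernel (SymOut_F n) (SymOut_H n) (P_map n) = normal_closure (SymOut_F n) (rho n ` {1..n})"
proof -
  interpret P: group_hom "SymOut_F n" "OutGroup (Hn n)" "P_map n" by (rule P_map_hom)
  interpret o: group_hom "AutoGroup (Hn n)" "OutGroup (Hn n)" "out_class (Hn n)"
    by (rule H.out_class_group_hom)
  show ?thesis
    unfolding kernel_P_map
  proof (rule subset_antisym)
    have "rho n i \<in> kernel (SymOut_F n) (OutGroup (Hn n)) (P_map n)" if i: "i \<in> {1..n}" for i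
    proof -
      have m: "gen_inversion n i \<in> core n (carrier (SymOut_F n))"
        using gen_inversion_sym[OF i] by (intro gen_inversion_core i) (simp add: rho_eq SymOut_def)
      then have "P_map n (rho n i) = out_class (Hn n) \<one>\<^bsub>AutoGroup (Hn n)\<^esub>"
        using P_map_out_class[OF gen_inversion_sym[OF i]] by (simp add: core_def rho_eq AutoGroup_simps(2))
      then show ?thesis
        using gen_inversion_sym[OF i] o.hom_one by (simp add: kernel_def rho_eq SymOut_def)
    qed
    then show "normal_closure (SymOut_F n) (rho n ` {1..n}) \<subseteq> kernel (SymOut_F n) (OutGroup (Hn n)) (P_map n)"
      unfolding normal_closure_def using P.normal_kernel by blast
  next
    show "kernel (SymOut_F n) (OutGroup (Hn n)) (P_map n) \<subseteq> normal_closure (SymOut_F n) (rho n ` {1..n})"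
      unfolding normal_closure_def
    proof (intro subsetI InterI, clarify)
      fix C N
      assume C: "C \<in> kernel (SymOut_F n) (OutGroup (Hn n)) (P_map n)"
        and N: "N \<lhd> SymOut_F n" and rho: "rho n ` {1..n} \<subseteq> N"
      obtain \<phi> where \<phi>: "\<phi> \<in> SymAut n" "C = out_class (Fn n) \<phi>"
        using C by (auto simp: kernel_def SymOut_def)
      have "out_class (Hn n) (reduction n \<phi>) = inner_auto (Hn n)"
        using C P_map_out_class[OF \<phi>(1)] by (simp add: kernel_def \<phi>(2) OutGroup_def)
      moreover have "reduction n \<phi> \<in> out_class (Hn n) (reduction n \<phi>)"
      proof -
        have "reduction n \<phi> = inner (Hn n) \<one>\<^bsub>Hn n\<^esub> \<otimes>\<^bsub>AutoGroup (Hn n)\<^esub> reduction n \<phi>"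
          using H.auto_mult_closed[OF H.inner_in_auto reduction_auto[OF \<phi>(1)], OF H.one_closed]
          by (intro extensionalityI[OF reduction_ext autoD(3)])
            (auto simp: H.auto_mult_apply H.inner_in_auto reduction_auto[OF \<phi>(1)] H.inner_one autoD(4))
        then show ?thesis unfolding H.out_class_eq[OF reduction_auto[OF \<phi>(1)]] using H.one_closed by blast
      qed
      ultimately obtain h where h: "h \<in> carrier (Hn n)" "reduction n \<phi> = inner (Hn n) h"
        by (auto simp: inner_auto_eq)
      obtain g where g: "g \<in> carrier (Fn n)" "pi_map n g = h" using pi_surj[OF h(1)] by blast
      (* another representative of C, which induces the identity on Hn instead of conjugation by h *)
      let ?i = "inner (Fn n) (inv\<^bsub>Fn n\<^esub> g)"
      let ?\<psi> = "?i \<otimes>\<^bsub>AutoGroup (Fn n)\<^esub> \<phi>"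
      have i: "?i \<in> SymAut n" using g(1) by (intro inner_sym_auto) simp
      have \<psi>: "?\<psi> \<in> SymAut n" "out_class (Fn n) ?\<psi> = C"
        using sym_auto_mult[OF i \<phi>(1)] F.out_class_inner_mult[of "inv\<^bsub>Fn n\<^esub> g" n \<phi>] sym_auto_autoD[OF \<phi>(1)] g(1) \<phi>(2)
        by simp_all
      have "reduction n ?\<psi> = (\<lambda>z\<in>carrier (Hn n). z)"
      proof (rule extensionalityI[OF reduction_ext])
        fix z assume z: "z \<in> carrier (Hn n)"
        have "reduction n ?\<psi> z = inner (Hn n) (inv\<^bsub>Hn n\<^esub> h) (inner (Hn n) h z)"
          using reduction_mult_apply[OF i \<phi>(1) z] reduction_inner[of "inv\<^bsub>Fn n\<^esub> g" n] g by (simp add: h(2))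
        then show "reduction n ?\<psi> z = (\<lambda>z\<in>carrier (Hn n). z) z"
          using h(1) z by (simp add: H.inner_mult_apply H.inner_one)
      qed simp
      then have "?\<psi> \<in> core n N"
        using trivial_reduction_in_core[OF N _ \<psi>(1)] rho by blast
      then show "C \<in> N" using \<psi>(2) by (simp add: core_def)
    qed
  qed
qed

end
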